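(* Let the distribution of agent types be given by a Borel probability measure $\mu$ on $X\subset\mathbf{R}^n$; unless $\mu$ vanishes on all Lipschitz hypersurfaces, adopt the tie-breaking conventions described in the context. If the preference function $b(x,y)$ satisfies hypotheses (B0)--(B3) listed in the context, and the manufacturing cost $c:\overline{Y}\to\mathbf{R}$ is $b^*$-convex, then the principal's problem $$\min\{L(u)\mid u\in\mathcal{U}_0\}$$ is a convex minimization over a convex set: $\mathcal{U}_0$ is a convex set and $L$ is a convex functional on $\mathcal{U}_0$.
   Context: $\overline{Z}$ denotes the closure of a set $Z\subset\mathbf{R}^n$. Hypotheses on $b$: (B0) $b\in C^4(\overline{X}\times\overline{Y})$, where $X,Y\subset\mathbf{R}^n$ are open and bounded. (B1) (bi-twist) For each $(x_0,y_0)\in\overline{X}\times\overline{Y}$, the maps $y\in\overline{Y}\mapsto D_xb(x_0,y)$ and $x\in\overline{X}\mapsto D_yb(x,y_0)$ are diffeomorphisms onto their ranges. (B2) (bi-convexity) For each $(x_0,y_0)\in\overline{X}\times\overline{Y}$, the sets $X_{y_0}:=D_yb(X,y_0)$ and $Y_{x_0}:=D_xb(x_0,Y)$ are convex subsets of $\mathbf{R}^n$. (B3) (non-negative cross-curvature) $$\frac{\partial^4}{\partial s^2\partial t^2}\Big|_{(s,t)=(0,0)}b(x(s),y(t))\ge 0$$ for each curve $t\in[-1,1]\mapsto (D_yb(x(t),y(0)),D_xb(x(0),y(t)))$ forming an affinely parameterized line segment in $\overline{X}_{y(0)}\times\overline{Y}_{x(0)}\subset\mathbf{R}^{2n}$,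 where $\overline{X}_{y}=D_yb(\overline{X},y)$ and $\overline{Y}_{x}=D_xb(x,\overline{Y})$. For $x\in\overline{X}$ and $q\in\overline{Y}_x$, $y_b(x,q)\in\overline{Y}$ denotes the unique solution of $D_xb(x,y_b(x,q))=q$. Transforms: for $v:\overline{Y}\to\mathbf{R}\cup\{+\infty\}$ and $u:\overline{X}\to\mathbf{R}$ put $v^b(x)=\sup_{y\in\overline{Y}}b(x,y)-v(y)$ and $u^{b^*}(y)=\sup_{x\in\overline{X}}b(x,y)-u(x)$. A function $u:\overline{X}\to\mathbf{R}$ is $b$-convex if $u=(u^{b^*})^b$; a function $v:\overline{Y}\to\mathbf{R}$ is $b^*$-convex if $v=(v^b)^{b^*}$. $\mathcal{V}^b_{\overline{Y}}$ denotes the set of $b$-convex functions. A point $y_\emptyset\in\overline{Y}$ (the null product) is fixed; $u_\emptyset(x):=b(x,y_\emptyset)-c(y_\emptyset)$ is the reservation utility, and $\mathcal{U}_0:=\{u\in\mathcal{V}^b_{\overline{Y}}\mid u\ge u_\emptyset\}$. The principal's net losses are $$L(u):=\int_X\big[u(x)+c(y_b(x,Du(x)))-b(x,y_b(x,Du(x)))\big]\,d\mu(x).$$ If $\mu$ assigns zero mass to each Lipschitz hypersurface, each $b$-convex $u$ is differentiable $\mu$-a.e. and $Du$ is its derivative. Otherwise the following tie-breaking conventions are adopted. The derivative is extended to all of $X$ by a measurable selection $Du(x)\in\partial u(x):=\{q\in\mathbf{R}^n\mid u(z)\ge u(x)+q\cdot(z-x)+o(|z-x|)\ \forall z\in X\}$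 chosen so that, with $v=u^{b^*}$, the response $y_b(x,Du(x))$ maximizes the principal's profit $v(y)-c(y)$ among all those $y\in\overline{Y}$ which maximize $b(x,y)-v(y)$ (equivalently, minimizes $c(y)-b(x,y)$ among those $y$). Moreover the principal's price menus are restricted to be $b^*$-convex, $v=(v^b)^{b^*}$. *)

theory Defs
  imports "HOL-Analysis.Analysis" "HOL-Probability.Probability"
begin

(* C^k up to the boundary: all partial derivatives of order at most k exist on the open set S and
   extend continuously to its closure. The values of f' at boundary points are those of the
   continuous extension; only its values on S are required to be derivatives. *)
primrec Ck_closure ::
  "nat \<Rightarrow> 'a::euclidean_space set \<Rightarrow> ('a \<Rightarrow> 'b::real_normed_vector) \<Rightarrow> bool" where
  "Ck_closure 0 S f \<longleftrightarrow> continuous_on (closure S) f"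
| "Ck_closure (Suc k) S f \<longleftrightarrow> continuous_on (closure S) f \<and>
     (\<exists>f'. (\<forall>x\<in>S. (f has_derivative f' x) (at x)) \<and>
           (\<forall>i\<in>Basis. Ck_closure k S (\<lambda>x. f' x i)))"

(* A diffeomorphism (C^1 up to the boundary, in both directions) of closure S onto its range.
   If f is continuous and injective on the bounded set closure S, with S open in R^n, then f ` S
   is open by invariance of domain, and closure (f ` S) = f ` closure S. *)
definition diffeo_onto_range ::
  "'a::euclidean_space set \<Rightarrow> ('a \<Rightarrow> 'a) \<Rightarrow> bool" where
  "diffeo_onto_range S f \<longleftrightarrow>
     inj_on f (closure S) \<and> Ck_closure 1 S f \<and>
     Ck_closure 1 (f ` S) (the_inv_into (closure S) f)"

(* The gradients D_x b and D_y b on closure X \<times> closure Y: the limit is the gradient itself at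
   points of X \<times> Y, and its continuous extension at boundary points. *)
definition Dx ::
  "(real^'n \<Rightarrow> real^'n \<Rightarrow> real) \<Rightarrow> (real^'n) set \<Rightarrow> (real^'n) set \<Rightarrow> real^'n \<Rightarrow> real^'n \<Rightarrow> real^'n" where
  "Dx b X Y x y = Lim (at (x, y) within X \<times> Y) (\<lambda>(x', y'). THE p. GDERIV (\<lambda>z. b z y') x' :> p)"

definition Dy ::
  "(real^'n \<Rightarrow> real^'n \<Rightarrow> real) \<Rightarrow> (real^'n) set \<Rightarrow> (real^'n) set \<Rightarrow> real^'n \<Rightarrow> real^'n \<Rightarrow> real^'n" where
  "Dy b X Y x y = Lim (at (x, y) within X \<times> Y) (\<lambda>(x', y'). THE p. GDERIV (\<lambda>z. b x' z) y' :> p)"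

definition B0 ::
  "(real^'n \<Rightarrow> real^'n \<Rightarrow> real) \<Rightarrow> (real^'n) set \<Rightarrow> (real^'n) set \<Rightarrow> bool" where
  "B0 b X Y \<longleftrightarrow> open X \<and> bounded X \<and> open Y \<and> bounded Y \<and>
     Ck_closure 4 (X \<times> Y) (\<lambda>(x, y). b x y)"

definition B1 ::
  "(real^'n \<Rightarrow> real^'n \<Rightarrow> real) \<Rightarrow> (real^'n) set \<Rightarrow> (real^'n) set \<Rightarrow> bool" where
  "B1 b X Y \<longleftrightarrow> (\<forall>x0\<in>closure X. \<forall>y0\<in>closure Y.
     diffeo_onto_range Y (\<lambda>y. Dx b X Y x0 y) \<and> diffeo_onto_range X (\<lambda>x. Dy b X Y x y0))"

definition B2 ::
  "(real^'n \<Rightarrow> real^'n \<Rightarrow> real) \<Rightarrow> (real^'n) set \<Rightarrow> (real^'n) set \<Rightarrow> bool" where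
  "B2 b X Y \<longleftrightarrow> (\<forall>x0\<in>closure X. \<forall>y0\<in>closure Y.
     convex ((\<lambda>x. Dy b X Y x y0) ` X) \<and> convex ((\<lambda>y. Dx b X Y x0 y) ` Y))"

definition B3 ::
  "(real^'n \<Rightarrow> real^'n \<Rightarrow> real) \<Rightarrow> (real^'n) set \<Rightarrow> (real^'n) set \<Rightarrow> bool" where
  "B3 b X Y \<longleftrightarrow> (\<forall>x y :: real \<Rightarrow> real^'n.
     (\<forall>t\<in>{-1..1}. x t \<in> closure X \<and> y t \<in> closure Y) \<and>
     (\<exists>p p' q q'. \<forall>t\<in>{-1..1}. Dy b X Y (x t) (y 0) = p + t *\<^sub>R p' \<and>
                              Dx b X Y (x 0) (y t) = q + t *\<^sub>R q') \<longrightarrow>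
     (deriv ^^ 2) (\<lambda>s. (deriv ^^ 2) (\<lambda>t. b (x s) (y t)) 0) 0 \<ge> 0)"

definition yb ::
  "(real^'n \<Rightarrow> real^'n \<Rightarrow> real) \<Rightarrow> (real^'n) set \<Rightarrow> (real^'n) set \<Rightarrow> real^'n \<Rightarrow> real^'n \<Rightarrow> real^'n" where
  "yb b X Y x q = the_inv_into (closure Y) (Dx b X Y x) q"

definition b_transform ::
  "('a \<Rightarrow> 'b::topological_space \<Rightarrow> real) \<Rightarrow> 'b set \<Rightarrow> ('b \<Rightarrow> ereal) \<Rightarrow> 'a \<Rightarrow> ereal" where
  "b_transform b Y v x = (SUP y\<in>closure Y. ereal (b x y) - v y)"

definition bstar_transform ::
  "('a::topological_space \<Rightarrow> 'b \<Rightarrow> real) \<Rightarrow> 'a set \<Rightarrow> ('a \<Rightarrow> ereal) \<Rightarrow> 'b \<Rightarrow> ereal" where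
  "bstar_transform b X u y = (SUP x\<in>closure X. ereal (b x y) - u x)"

definition b_convex ::
  "(real^'n \<Rightarrow> real^'n \<Rightarrow> real) \<Rightarrow> (real^'n) set \<Rightarrow> (real^'n) set \<Rightarrow> (real^'n \<Rightarrow> real) \<Rightarrow> bool" where
  "b_convex b X Y u \<longleftrightarrow> (\<forall>x\<in>closure X.
     ereal (u x) = b_transform b Y (bstar_transform b X (\<lambda>z. ereal (u z))) x)"

definition bstar_convex ::
  "(real^'n \<Rightarrow> real^'n \<Rightarrow> real) \<Rightarrow> (real^'n) set \<Rightarrow> (real^'n) set \<Rightarrow> (real^'n \<Rightarrow> real) \<Rightarrow> bool" where
  "bstar_convex b X Y v \<longleftrightarrow> (\<forall>y\<in>closure Y.
     ereal (v y) = bstar_transform b X (b_transform b Y (\<lambda>z. ereal (v z))) y)"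

(* Functions on closure X are represented by total functions; values off closure X play no role. *)
definition U0 ::
  "(real^'n \<Rightarrow> real^'n \<Rightarrow> real) \<Rightarrow> (real^'n \<Rightarrow> real) \<Rightarrow> (real^'n) set \<Rightarrow> (real^'n) set \<Rightarrow> real^'n
     \<Rightarrow> (real^'n \<Rightarrow> real) set" where
  "U0 b c X Y y_null =
     {u. b_convex b X Y u \<and> (\<forall>x\<in>closure X. u x \<ge> b x y_null - c y_null)}"

(* S is locally the graph of a Lipschitz function over a hyperplane with unit normal \<nu>. *)
definition lipschitz_hypersurface :: "'a::euclidean_space set \<Rightarrow> bool" where
  "lipschitz_hypersurface S \<longleftrightarrow> (\<forall>p\<in>S. \<exists>W \<nu> f K. open W \<and> p \<in> W \<and> norm \<nu> = 1 \<and>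
     K-lipschitz_on {z. z \<bullet> \<nu> = 0} f \<and>
     S \<inter> W = {z + f z *\<^sub>R \<nu> | z. z \<bullet> \<nu> = 0} \<inter> W)"

definition vanishes_on_lipschitz_hypersurfaces :: "'a::euclidean_space measure \<Rightarrow> bool" where
  "vanishes_on_lipschitz_hypersurfaces \<mu> \<longleftrightarrow>
     (\<forall>S. lipschitz_hypersurface S \<longrightarrow> S \<inter> space \<mu> \<in> null_sets \<mu>)"

definition subdifferential ::
  "'a::real_inner set \<Rightarrow> ('a \<Rightarrow> real) \<Rightarrow> 'a \<Rightarrow> 'a set" where
  "subdifferential X u x = {q. \<exists>r \<in> o[at x](\<lambda>z. norm (z - x)).
     \<forall>z\<in>X. u z \<ge> u x + q \<bullet> (z - x) + r z}"

definition best_responses ::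
  "(real^'n \<Rightarrow> real^'n \<Rightarrow> real) \<Rightarrow> (real^'n) set \<Rightarrow> (real^'n \<Rightarrow> ereal) \<Rightarrow> real^'n \<Rightarrow> (real^'n) set" where
  "best_responses b Y v x = {y \<in> closure Y.
     \<forall>z\<in>closure Y. ereal (b x z) - v z \<le> ereal (b x y) - v y}"

(* Du is the derivative of u wherever it exists. Nothing is required elsewhere. *)
definition is_derivative_on ::
  "'a::real_inner set \<Rightarrow> ('a \<Rightarrow> real) \<Rightarrow> ('a \<Rightarrow> 'a) \<Rightarrow> bool" where
  "is_derivative_on X u Du \<longleftrightarrow> (\<forall>x\<in>X. u differentiable (at x) \<longrightarrow> GDERIV u x :> Du x)"

(* The price menu v = u^{b*} is automatically b*-convex, i.e. v = (v^b)^{b*}. *)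
definition tie_breaking_selection ::
  "(real^'n \<Rightarrow> real^'n \<Rightarrow> real) \<Rightarrow> (real^'n \<Rightarrow> real) \<Rightarrow> (real^'n) set \<Rightarrow> (real^'n) set
     \<Rightarrow> (real^'n) measure \<Rightarrow> (real^'n \<Rightarrow> real) \<Rightarrow> (real^'n \<Rightarrow> real^'n) \<Rightarrow> bool" where
  "tie_breaking_selection b c X Y \<mu> u Du \<longleftrightarrow>
     Du \<in> borel_measurable (completion \<mu>) \<and>
     (let v = bstar_transform b X (\<lambda>x. ereal (u x)) in
      \<forall>x\<in>X. Du x \<in> subdifferential X u x \<and>
        yb b X Y x (Du x) \<in> best_responses b Y v x \<and>
        (\<forall>y\<in>best_responses b Y v x.
           v y - ereal (c y) \<le> v (yb b X Y x (Du x)) - ereal (c (yb b X Y x (Du x)))))"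

definition loss_density ::
  "(real^'n \<Rightarrow> real^'n \<Rightarrow> real) \<Rightarrow> (real^'n \<Rightarrow> real) \<Rightarrow> (real^'n) set \<Rightarrow> (real^'n) set
     \<Rightarrow> (real^'n \<Rightarrow> real) \<Rightarrow> (real^'n \<Rightarrow> real^'n) \<Rightarrow> real^'n \<Rightarrow> real" where
  "loss_density b c X Y u Du x = u x + c (yb b X Y x (Du x)) - b x (yb b X Y x (Du x))"

(* The measure is completed so that an integrand prescribed only almost everywhere
   (Du may be defined only up to a null set) has a well-defined integral. *)
definition net_loss ::
  "(real^'n \<Rightarrow> real^'n \<Rightarrow> real) \<Rightarrow> (real^'n \<Rightarrow> real) \<Rightarrow> (real^'n) set \<Rightarrow> (real^'n) set
     \<Rightarrow> (real^'n) measure \<Rightarrow> (real^'n \<Rightarrow> real) \<Rightarrow> (real^'n \<Rightarrow> real^'n) \<Rightarrow> real" where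
  "net_loss b c X Y \<mu> u Du = (LINT x|completion \<mu>. loss_density b c X Y u Du x)"

end

theory Submission
  imports Defs
begin

text \<open>Everything rests on one property of the preference function, lemma \<open>intermediate_product\<close>.
Given a type \<open>x0\<close>, two products \<open>y0\<close>, \<open>y1\<close> and a weight \<open>t\<close>, there is a product \<open>y\<close> whose value
relative to \<open>x0\<close>, that is \<open>b x y - b x0 y\<close>, is for all types \<open>x\<close> at once at most the weighted mean
of the relative values of \<open>y0\<close> and \<open>y1\<close>. The product \<open>y\<close> is the one whose gradient
\<open>D_x b (x0, y)\<close> is the weighted mean of the gradients of \<open>y0\<close> and \<open>y1\<close>; it exists by bi-convexity, and
the inequality says that \<open>b x - b x0\<close> is convex along products with affine gradient at \<open>x0\<close>. This
convexity is what non-negative cross-curvature means, once the fourth derivative at one point is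
integrated twice along a segment of types (\<open>b_difference_convex_along_y_segment\<close>).

The rest compares supports. A function \<open>u\<close> is b-convex if and only if every type \<open>x0\<close> has a product
\<open>y\<close> with \<open>u x \<ge> u x0 + b x y - b x0 y\<close> for all \<open>x\<close>. If \<open>y0\<close> and \<open>y1\<close> support \<open>u0\<close> and \<open>u1\<close> at \<open>x0\<close>,
then the intermediate product supports the mixture of \<open>u0\<close> and \<open>u1\<close>; hence mixtures are
b-convex. The cost \<open>c\<close> is an upper envelope of functions \<open>b x\<close> minus constants, so the intermediate
product also satisfies the mean inequality for \<open>c y - b x0 y\<close> (\<open>support_of_convex_combination\<close>). The
loss at \<open>x0\<close> is \<open>u x0 + c y - b x0 y\<close> for a supporting product \<open>y\<close> which is cheapest in this sense,
so the loss density of the mixture is at most the mixture of the loss densities.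

That the agent's response is a cheapest supporting product is the content of the tie-breaking
convention. When \<open>\<mu>\<close> vanishes on Lipschitz hypersurfaces it holds almost everywhere because the
supporting product is unique: types with two supporting products lie on countably many Lipschitz
graphs (\<open>multiple_supports_covered\<close>), and elsewhere \<open>u\<close> is differentiable and its gradient
determines the product (\<open>has_derivative_if_unique_support\<close>, \<open>gradient_at_support\<close>).\<close>

section \<open>Calculus of iterated directional derivatives\<close>

definition dir_deriv ::
  "'a::real_normed_vector \<Rightarrow> ('a \<Rightarrow> 'b::real_normed_vector) \<Rightarrow> 'a \<Rightarrow> 'b" where
  "dir_deriv w f x = frechet_derivative f (at x) w"

text \<open>Asking for all directions, and not only for those of a basis, makes stability under affine
changes of variable immediate, and lets directions vary along a curve.\<close>

primrec Ck_on :: "nat \<Rightarrow> 'a::euclidean_space set \<Rightarrow> ('a \<Rightarrow> 'b::real_normed_vector) \<Rightarrow> bool" where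
  "Ck_on 0 S f \<longleftrightarrow> continuous_on S f"
| "Ck_on (Suc k) S f \<longleftrightarrow> (\<forall>x\<in>S. f differentiable (at x)) \<and> (\<forall>w. Ck_on k S (dir_deriv w f))"

lemma Ck_on_SucD:
  assumes "Ck_on (Suc k) S f"
  shows "x \<in> S \<Longrightarrow> f differentiable (at x)" "Ck_on k S (dir_deriv w f)"
  using assms by simp_all

lemma dir_deriv_eq: "(f has_derivative f') (at x) \<Longrightarrow> dir_deriv w f x = f' w"
  unfolding dir_deriv_def by (metis frechet_derivative_at)

lemma has_derivative_dir_deriv:
  "f differentiable (at x) \<Longrightarrow> (f has_derivative (\<lambda>w. dir_deriv w f x)) (at x)"
  unfolding dir_deriv_def by (metis frechet_derivative_works)

lemma linear_dir_deriv: "f differentiable (at x) \<Longrightarrow> linear (\<lambda>w. dir_deriv w f x)"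
  using has_derivative_dir_deriv has_derivative_linear by blast

lemma dir_deriv_cong:
  assumes "open S" "x \<in> S" "\<And>z. z \<in> S \<Longrightarrow> f z = g z" "f differentiable (at x)"
  shows "dir_deriv w f x = dir_deriv w g x"
proof -
  have "(g has_derivative (\<lambda>w. dir_deriv w f x)) (at x)"
    using has_derivative_transform_within_open[OF has_derivative_dir_deriv[OF assms(4)] assms(1,2,3)] .
  then show ?thesis using dir_deriv_eq by metis
qed

lemma Ck_on_cong:
  assumes "open S"
  shows "(\<And>x. x \<in> S \<Longrightarrow> f x = g x) \<Longrightarrow> Ck_on k S f \<Longrightarrow> Ck_on k S g"
proof (induction k arbitrary: f g)
  case 0 then show ?case using continuous_on_cong[of S S f g] by simp
next
  case (Suc k)
  have "g differentiable (at x)" if "x \<in> S" for x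
  proof -
    have "f differentiable (at x)" using Suc.prems that by simp
    then show ?thesis
      using has_derivative_transform_within_open[of f _ x UNIV S g] assms that Suc.prems(1)
      unfolding differentiable_def by blast
  qed
  moreover have "Ck_on k S (dir_deriv w g)" for w
  proof (rule Suc.IH)
    show "Ck_on k S (dir_deriv w f)" using Suc.prems by simp
    show "dir_deriv w f x = dir_deriv w g x" if "x \<in> S" for x
      by (rule dir_deriv_cong[OF assms that Suc.prems(1)])
        (use Ck_on_SucD(1)[OF Suc.prems(2)] that in auto)
  qed
  ultimately show ?case by simp
qed

lemma Ck_on_imp_continuous_on: "Ck_on k S f \<Longrightarrow> continuous_on S f"
  by (cases k) (auto intro!: differentiable_imp_continuous_on differentiable_at_imp_differentiable_on)

lemma Ck_on_decrease: "Ck_on (Suc k) S f \<Longrightarrow> Ck_on k S f"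
proof (induction k arbitrary: f)
  case 0
  then show ?case using Ck_on_imp_continuous_on by fastforce
next
  case (Suc k)
  then show ?case by (metis Ck_on.simps(2))
qed

lemma Ck_on_mono: "Ck_on n S f \<Longrightarrow> m \<le> n \<Longrightarrow> Ck_on m S f"
proof (induction n)
  case (Suc n)
  then show ?case using Ck_on_decrease[of n S f] le_Suc_eq by auto
qed simp

lemma Ck_on_bounded_linear:
  assumes "open S" "bounded_linear L"
  shows "Ck_on k S f \<Longrightarrow> Ck_on k S (\<lambda>x. L (f x))"
proof (induction k arbitrary: f)
  case 0
  then show ?case
    using bounded_linear.continuous_on[OF assms(2)] by simp
next
  case (Suc k)
  have d: "((\<lambda>x. L (f x)) has_derivative (\<lambda>w. L (dir_deriv w f x))) (at x)" if "x \<in> S" for x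
    by (intro bounded_linear.has_derivative[OF assms(2)] has_derivative_dir_deriv
        Ck_on_SucD(1)[OF Suc.prems] that)
  have "Ck_on k S (dir_deriv w (\<lambda>x. L (f x)))" for w
    by (rule Ck_on_cong[OF assms(1) _ Suc.IH[of "dir_deriv w f"]])
      (use d dir_deriv_eq Suc.prems in fastforce)+
  then show ?case using d by (auto simp: differentiable_def)
qed

lemma Ck_on_add:
  assumes "open S"
  shows "Ck_on k S f \<Longrightarrow> Ck_on k S g \<Longrightarrow> Ck_on k S (\<lambda>x. f x + g x)"
proof (induction k arbitrary: f g)
  case 0
  then show ?case by (simp add: continuous_on_add)
next
  case (Suc k)
  have d: "((\<lambda>x. f x + g x) has_derivative (\<lambda>w. dir_deriv w f x + dir_deriv w g x)) (at x)"
    if "x \<in> S" for x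
    by (intro has_derivative_add has_derivative_dir_deriv Ck_on_SucD(1)[OF Suc.prems(1)]
        Ck_on_SucD(1)[OF Suc.prems(2)] that)
  have "Ck_on k S (dir_deriv w (\<lambda>x. f x + g x))" for w
    by (rule Ck_on_cong[OF assms(1) _ Suc.IH[of "dir_deriv w f" "dir_deriv w g"]])
      (use d dir_deriv_eq Suc.prems in fastforce)+
  then show ?case using d by (auto simp: differentiable_def)
qed

lemma Ck_on_const: "Ck_on k S (\<lambda>x. c)"
proof (induction k arbitrary: c)
  case (Suc k)
  have "dir_deriv w (\<lambda>x::'a. c) = (\<lambda>x. 0)" for w
    by (rule ext) (simp add: dir_deriv_def)
  then show ?case using Suc by simp
qed simp

lemma Ck_on_sum:
  assumes "open S" "finite I" "\<And>i. i \<in> I \<Longrightarrow> Ck_on k S (f i)"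
  shows "Ck_on k S (\<lambda>x. \<Sum>i\<in>I. f i x)"
  using assms(2,3)
  by (induction I rule: finite_induct) (auto intro!: Ck_on_const Ck_on_add[OF assms(1)])

lemma Ck_on_compose_affine:
  assumes "open S" "open T" "bounded_linear l" "\<And>z. z \<in> T \<Longrightarrow> a + l z \<in> S"
  shows "Ck_on k S f \<Longrightarrow> Ck_on k T (\<lambda>z. f (a + l z))"
proof (induction k arbitrary: f)
  case 0
  have "continuous_on T (\<lambda>z. a + l z)"
    by (intro continuous_intros bounded_linear.continuous_on[OF assms(3)])
  then show ?case using 0 assms(4)
    by (auto intro!: continuous_on_compose2[of S f])
next
  case (Suc k)
  have d: "((\<lambda>z. f (a + l z)) has_derivative (\<lambda>w. dir_deriv (l w) f (a + l z))) (at z)"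
    if "z \<in> T" for z
  proof -
    have "((\<lambda>z. a + l z) has_derivative l) (at z)"
      using bounded_linear_imp_has_derivative[OF assms(3), of "at z"]
      by (auto intro!: derivative_eq_intros)
    moreover have "(f has_derivative (\<lambda>w. dir_deriv w f (a + l z))) (at (a + l z))"
      using has_derivative_dir_deriv Suc.prems assms(4) that by auto
    ultimately show ?thesis by (rule has_derivative_compose)
  qed
  have "Ck_on k T (dir_deriv w (\<lambda>z. f (a + l z)))" for w
    by (rule Ck_on_cong[OF assms(2) _ Suc.IH[of "dir_deriv (l w) f"]])
      (use d dir_deriv_eq Suc.prems in fastforce)+
  then show ?case using d by (auto simp: differentiable_def)
qed

lemma linear_basis_expansion:
  fixes L :: "'a::euclidean_space \<Rightarrow> 'b::real_vector"
  assumes "linear L" shows "L w = (\<Sum>i\<in>Basis. (w \<bullet> i) *\<^sub>R L i)"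
proof -
  have "L w = L (\<Sum>i\<in>Basis. (w \<bullet> i) *\<^sub>R i)" by (simp add: euclidean_representation)
  also have "\<dots> = (\<Sum>i\<in>Basis. (w \<bullet> i) *\<^sub>R L i)"
    using assms by (simp add: linear_sum linear_scale)
  finally show ?thesis .
qed

lemma Ck_closure_imp_Ck_on:
  assumes "open S"
  shows "Ck_closure k S f \<Longrightarrow> Ck_on k S f"
proof (induction k arbitrary: f)
  case 0 then show ?case using continuous_on_subset[OF _ closure_subset] by simp
next
  case (Suc k)
  then obtain f' where f': "\<And>x. x \<in> S \<Longrightarrow> (f has_derivative f' x) (at x)"
      "\<And>i. i \<in> Basis \<Longrightarrow> Ck_closure k S (\<lambda>x. f' x i)" by auto
  have "Ck_on k S (dir_deriv w f)" for w
  proof (rule Ck_on_cong[OF assms])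
    show "Ck_on k S (\<lambda>x. \<Sum>i\<in>Basis. (w \<bullet> i) *\<^sub>R f' x i)"
      by (intro Ck_on_sum assms Ck_on_bounded_linear[OF _ bounded_linear_scaleR_right] Suc.IH f')
        auto
    show "(\<Sum>i\<in>Basis. (w \<bullet> i) *\<^sub>R f' x i) = dir_deriv w f x" if "x \<in> S" for x
      using dir_deriv_eq[OF f'(1)[OF that], of w]
        linear_basis_expansion[OF has_derivative_linear[OF f'(1)[OF that]]] by metis
  qed
  then show ?case using f'(1) by (auto simp: differentiable_def)
qed

lemma dir_deriv_along_curve:
  assumes "f differentiable (at (\<gamma> t))" "(\<gamma> has_vector_derivative \<gamma>') (at t)"
  shows "((\<lambda>t. f (\<gamma> t)) has_vector_derivative dir_deriv \<gamma>' f (\<gamma> t)) (at t)"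
proof -
  have "((\<lambda>t. f (\<gamma> t)) has_derivative (\<lambda>h. dir_deriv (h *\<^sub>R \<gamma>') f (\<gamma> t))) (at t)"
    using has_derivative_compose[OF assms(2)[unfolded has_vector_derivative_def]
        has_derivative_dir_deriv[OF assms(1)]] .
  then show ?thesis
    unfolding has_vector_derivative_def
    using linear_scale[OF linear_dir_deriv[OF assms(1)]] by simp
qed

lemma eventually_curve_in_open:
  assumes "open S" "(\<gamma> has_vector_derivative \<gamma>') (at t)" "\<gamma> t \<in> S"
  shows "\<forall>\<^sub>F s in nhds t. \<gamma> s \<in> S"
proof -
  have "isCont \<gamma> t" using has_vector_derivative_continuous assms(2) by blast
  then have "(\<gamma> \<longlongrightarrow> \<gamma> t) (nhds t)" by (simp add: continuous_at tendsto_at_iff_tendsto_nhds)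
  then show ?thesis using topological_tendstoD assms(1,3) by blast
qed

text \<open>The direction moves with the curve. Expanding it in the basis separates its
derivative, which gives the acceleration term, from the derivative of the partial derivatives.\<close>

lemma second_dir_deriv_along_curve:
  fixes f :: "'a::euclidean_space \<Rightarrow> 'b::real_normed_vector"
  assumes S: "open S" and f: "Ck_on 2 S f" and t: "\<gamma> t \<in> S"
    and g': "(\<gamma> has_vector_derivative \<gamma>' t) (at t)"
    and g'': "(\<gamma>' has_vector_derivative \<gamma>'') (at t)"
  shows "((\<lambda>t. dir_deriv (\<gamma>' t) f (\<gamma> t)) has_vector_derivative
          dir_deriv \<gamma>'' f (\<gamma> t) + dir_deriv (\<gamma>' t) (dir_deriv (\<gamma>' t) f) (\<gamma> t)) (at t)"
proof -
  have df: "f differentiable (at x)" "dir_deriv w f differentiable (at x)" if "x \<in> S" for x w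
    using f that by (simp_all add: numeral_2_eq_2)
  have expand: "dir_deriv w f x = (\<Sum>i\<in>Basis. (w \<bullet> i) *\<^sub>R dir_deriv i f x)" if "x \<in> S" for w x
    using linear_basis_expansion[OF linear_dir_deriv[OF df(1)[OF that]]] .
  have sums: "((\<lambda>x. \<Sum>i\<in>Basis. (w \<bullet> i) *\<^sub>R dir_deriv i f x) has_derivative
       (\<lambda>v. \<Sum>i\<in>Basis. (w \<bullet> i) *\<^sub>R dir_deriv v (dir_deriv i f) (\<gamma> t))) (at (\<gamma> t))" for w
    by (intro has_derivative_sum has_derivative_scaleR_right has_derivative_dir_deriv df t)
  have expand2: "dir_deriv v (dir_deriv w f) (\<gamma> t)
      = (\<Sum>i\<in>Basis. (w \<bullet> i) *\<^sub>R dir_deriv v (dir_deriv i f) (\<gamma> t))" for v w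
    by (rule trans[OF dir_deriv_cong[OF S t expand df(2)[OF t]] dir_deriv_eq[OF sums]])
  have "((\<lambda>t. \<Sum>i\<in>Basis. (\<gamma>' t \<bullet> i) *\<^sub>R dir_deriv i f (\<gamma> t)) has_vector_derivative
      (\<Sum>i\<in>Basis. (\<gamma>' t \<bullet> i) *\<^sub>R dir_deriv (\<gamma>' t) (dir_deriv i f) (\<gamma> t)
         + (\<gamma>'' \<bullet> i) *\<^sub>R dir_deriv i f (\<gamma> t))) (at t)"
  proof (intro has_vector_derivative_sum has_vector_derivative_scaleR)
    fix i :: 'a assume "i \<in> Basis"
    show "((\<lambda>t. \<gamma>' t \<bullet> i) has_real_derivative \<gamma>'' \<bullet> i) (at t)"
      using bounded_linear.has_vector_derivative[OF bounded_linear_inner_left g'']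
      by (simp add: has_real_derivative_iff_has_vector_derivative)
    show "((\<lambda>t. dir_deriv i f (\<gamma> t)) has_vector_derivative dir_deriv (\<gamma>' t) (dir_deriv i f) (\<gamma> t)) (at t)"
      by (rule dir_deriv_along_curve[OF df(2)[OF t] g'])
  qed
  moreover have "(\<Sum>i\<in>Basis. (\<gamma>' t \<bullet> i) *\<^sub>R dir_deriv (\<gamma>' t) (dir_deriv i f) (\<gamma> t)
         + (\<gamma>'' \<bullet> i) *\<^sub>R dir_deriv i f (\<gamma> t))
      = dir_deriv \<gamma>'' f (\<gamma> t) + dir_deriv (\<gamma>' t) (dir_deriv (\<gamma>' t) f) (\<gamma> t)"
    by (simp only: sum.distrib expand2[of "\<gamma>' t" "\<gamma>' t"] expand[OF t, of \<gamma>''] add.commute)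
  moreover obtain T where T: "open T" "t \<in> T" "\<And>s. s \<in> T \<Longrightarrow> \<gamma> s \<in> S"
    using eventually_curve_in_open[OF S g' t] by (auto simp: eventually_nhds)
  ultimately show ?thesis
    using has_vector_derivative_transform_within_open[OF _ T(1,2), of
      "\<lambda>t. \<Sum>i\<in>Basis. (\<gamma>' t \<bullet> i) *\<^sub>R dir_deriv i f (\<gamma> t)" _ "\<lambda>t. dir_deriv (\<gamma>' t) f (\<gamma> t)"]
      expand T(3) by simp
qed

text \<open>The mean value theorem is applied first to the difference of two parallel
edges of the parallelogram and then to the derivative along the remaining edge.\<close>

lemma second_difference_mean_value:
  fixes f :: "'a::euclidean_space \<Rightarrow> real"
  assumes f: "Ck_on 2 S f" and "0 < h"
    and in_S: "\<And>s t. 0 \<le> s \<Longrightarrow> s \<le> h \<Longrightarrow> 0 \<le> t \<Longrightarrow> t \<le> h \<Longrightarrow> z + s *\<^sub>R v + t *\<^sub>R w \<in> S"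
  obtains s t where "0 < s" "s < h" "0 < t" "t < h"
    "f (z + h *\<^sub>R v + h *\<^sub>R w) - f (z + h *\<^sub>R v) - f (z + h *\<^sub>R w) + f z
     = h\<^sup>2 * dir_deriv w (dir_deriv v f) (z + s *\<^sub>R v + t *\<^sub>R w)"
proof -
  have df: "f differentiable (at x)" "dir_deriv w f differentiable (at x)" if "x \<in> S" for x w
    using f that by (simp_all add: numeral_2_eq_2)
  have d1: "((\<lambda>s. f (z + s *\<^sub>R v + t *\<^sub>R w)) has_real_derivative
       dir_deriv v f (z + s *\<^sub>R v + t *\<^sub>R w)) (at s)" if "0 \<le> s" "s \<le> h" "0 \<le> t" "t \<le> h" for s t
    unfolding has_real_derivative_iff_has_vector_derivative
    by (rule dir_deriv_along_curve[where \<gamma> = "\<lambda>s. z + s *\<^sub>R v + t *\<^sub>R w"], rule df, rule in_S)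
      (use that in \<open>auto simp: has_vector_derivative_def intro!: derivative_eq_intros\<close>)
  define \<phi> where "\<phi> s = f (z + s *\<^sub>R v + h *\<^sub>R w) - f (z + s *\<^sub>R v)" for s
  have "(\<phi> has_real_derivative dir_deriv v f (z + s *\<^sub>R v + h *\<^sub>R w) - dir_deriv v f (z + s *\<^sub>R v)) (at s)"
    if "0 \<le> s" "s \<le> h" for s
  proof -
    have "((\<lambda>s. f (z + s *\<^sub>R v)) has_real_derivative dir_deriv v f (z + s *\<^sub>R v)) (at s)"
      using d1[OF that, of 0] \<open>0 < h\<close> by simp
    moreover have "((\<lambda>s. f (z + s *\<^sub>R v + h *\<^sub>R w)) has_real_derivative
        dir_deriv v f (z + s *\<^sub>R v + h *\<^sub>R w)) (at s)"
      using d1[OF that, of h] \<open>0 < h\<close> by simp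
    ultimately show ?thesis unfolding \<phi>_def by (rule DERIV_diff[rotated])
  qed
  then obtain s where s: "0 < s" "s < h" and
    e1: "\<phi> h - \<phi> 0 = (h - 0) * (dir_deriv v f (z + s *\<^sub>R v + h *\<^sub>R w) - dir_deriv v f (z + s *\<^sub>R v))"
    using MVT2[of 0 h \<phi> "\<lambda>s. dir_deriv v f (z + s *\<^sub>R v + h *\<^sub>R w) - dir_deriv v f (z + s *\<^sub>R v)"]
      \<open>0 < h\<close> by metis
  have "((\<lambda>t. dir_deriv v f (z + s *\<^sub>R v + t *\<^sub>R w)) has_real_derivative
       dir_deriv w (dir_deriv v f) (z + s *\<^sub>R v + t *\<^sub>R w)) (at t)" if "0 \<le> t" "t \<le> h" for t
    unfolding has_real_derivative_iff_has_vector_derivative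
    by (rule dir_deriv_along_curve[where \<gamma> = "\<lambda>t. z + s *\<^sub>R v + t *\<^sub>R w"], rule df, rule in_S)
      (use s that in \<open>auto simp: has_vector_derivative_def intro!: derivative_eq_intros\<close>)
  then obtain t where t: "0 < t" "t < h" and
    e2: "dir_deriv v f (z + s *\<^sub>R v + h *\<^sub>R w) - dir_deriv v f (z + s *\<^sub>R v + 0 *\<^sub>R w)
      = (h - 0) * dir_deriv w (dir_deriv v f) (z + s *\<^sub>R v + t *\<^sub>R w)"
    using MVT2[of 0 h "\<lambda>t. dir_deriv v f (z + s *\<^sub>R v + t *\<^sub>R w)"
        "\<lambda>t. dir_deriv w (dir_deriv v f) (z + s *\<^sub>R v + t *\<^sub>R w)"] \<open>0 < h\<close> by metis
  show ?thesis
    by (rule that[OF s t]) (use e1 e2 in \<open>simp add: \<phi>_def power2_eq_square algebra_simps\<close>)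
qed

text \<open>The second difference over a small parallelogram is symmetric in the two edges, and by
the mean value theorem it approximates both iterated derivatives, which are continuous.\<close>

lemma dir_deriv_commute:
  fixes f :: "'a::euclidean_space \<Rightarrow> real"
  assumes S: "open S" and z: "z \<in> S" and f: "Ck_on 2 S f"
  shows "dir_deriv w (dir_deriv v f) z = dir_deriv v (dir_deriv w f) z"
proof (rule ccontr)
  assume ne: "\<not> ?thesis"
  \<comment> \<open>Both derivatives stay within half their distance at \<open>z\<close> from their values there, so they cannot meet.\<close>
  define e where "e = \<bar>dir_deriv w (dir_deriv v f) z - dir_deriv v (dir_deriv w f) z\<bar> / 2"
  have "e > 0" using ne by (simp add: e_def)
  have cont: "continuous_on S (dir_deriv w (dir_deriv v f))" for v w
    using f by (simp add: numeral_2_eq_2)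
  have "\<forall>\<^sub>F x in nhds z. x \<in> S \<and>
      dist (dir_deriv w (dir_deriv v f) x) (dir_deriv w (dir_deriv v f) z) < e \<and>
      dist (dir_deriv v (dir_deriv w f) x) (dir_deriv v (dir_deriv w f) z) < e"
    using cont[of w v] cont[of v w] S z \<open>e > 0\<close>
    by (intro eventually_conj eventually_nhds_in_open tendstoD)
      (auto simp: continuous_on_eq_continuous_at continuous_at tendsto_at_iff_tendsto_nhds)
  then obtain d where "d > 0" and d: "\<And>x. dist x z < d \<Longrightarrow> x \<in> S \<and>
      dist (dir_deriv w (dir_deriv v f) x) (dir_deriv w (dir_deriv v f) z) < e \<and>
      dist (dir_deriv v (dir_deriv w f) x) (dir_deriv v (dir_deriv w f) z) < e"
    unfolding eventually_nhds_metric by blast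
  \<comment> \<open>The parallelogram with edges \<open>h *\<^sub>R v\<close> and \<open>h *\<^sub>R w\<close> fits into the ball of radius \<open>d\<close>.\<close>
  define h where "h = d / (2 * (norm v + norm w + 1))"
  have pos: "norm v + norm w + 1 > 0" by (smt (verit) norm_ge_zero)
  then have "h > 0" using \<open>d > 0\<close> by (simp add: h_def)
  have hd: "h * (norm v + norm w) < d"
  proof -
    have "h * (norm v + norm w) < h * (norm v + norm w + 1)" using \<open>h > 0\<close> by simp
    also have "\<dots> = d / 2" unfolding h_def using pos by (simp add: field_simps)
    finally show ?thesis using \<open>d > 0\<close> by simp
  qed
  have near: "dist (z + s *\<^sub>R v + t *\<^sub>R w) z < d" if "0 \<le> s" "s \<le> h" "0 \<le> t" "t \<le> h" for s t
  proof -
    have "norm (s *\<^sub>R v + t *\<^sub>R w) \<le> s * norm v + t * norm w"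
      using norm_triangle_ineq[of "s *\<^sub>R v" "t *\<^sub>R w"] that by simp
    also have "\<dots> \<le> h * norm v + h * norm w" using that by (intro add_mono mult_right_mono) auto
    also have "\<dots> = h * (norm v + norm w)" by (simp add: algebra_simps)
    finally show ?thesis using hd by (simp add: dist_norm add.assoc)
  qed
  obtain s t where 1: "0 < s" "s < h" "0 < t" "t < h"
    "f (z + h *\<^sub>R v + h *\<^sub>R w) - f (z + h *\<^sub>R v) - f (z + h *\<^sub>R w) + f z
     = h\<^sup>2 * dir_deriv w (dir_deriv v f) (z + s *\<^sub>R v + t *\<^sub>R w)"
    by (rule second_difference_mean_value[OF f \<open>h > 0\<close>, of z v w]) (use near d in blast)+
  have near': "dist (z + s *\<^sub>R w + t *\<^sub>R v) z < d" if "0 \<le> s" "s \<le> h" "0 \<le> t" "t \<le> h" for s t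
    using near[of t s] that by (simp add: add.commute add.left_commute)
  obtain s' t' where 2: "0 < s'" "s' < h" "0 < t'" "t' < h"
    "f (z + h *\<^sub>R w + h *\<^sub>R v) - f (z + h *\<^sub>R w) - f (z + h *\<^sub>R v) + f z
     = h\<^sup>2 * dir_deriv v (dir_deriv w f) (z + s' *\<^sub>R w + t' *\<^sub>R v)"
    by (rule second_difference_mean_value[OF f \<open>h > 0\<close>, of z w v]) (use near' d in blast)+
  have "h\<^sup>2 * dir_deriv w (dir_deriv v f) (z + s *\<^sub>R v + t *\<^sub>R w)
      = h\<^sup>2 * dir_deriv v (dir_deriv w f) (z + s' *\<^sub>R w + t' *\<^sub>R v)"
  proof -
    have "z + h *\<^sub>R w + h *\<^sub>R v = z + h *\<^sub>R v + h *\<^sub>R w" by simp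
    with 1(5) 2(5)[unfolded this] show ?thesis by linarith
  qed
  then have "dir_deriv w (dir_deriv v f) (z + s *\<^sub>R v + t *\<^sub>R w)
      = dir_deriv v (dir_deriv w f) (z + s' *\<^sub>R w + t' *\<^sub>R v)" using \<open>h > 0\<close> by simp
  moreover have "dist (dir_deriv w (dir_deriv v f) (z + s *\<^sub>R v + t *\<^sub>R w)) (dir_deriv w (dir_deriv v f) z) < e"
    using d[OF near[of s t]] 1(1-4) by auto
  moreover have "dist (dir_deriv v (dir_deriv w f) (z + s' *\<^sub>R w + t' *\<^sub>R v)) (dir_deriv v (dir_deriv w f) z) < e"
    using d[OF near'[of s' t']] 2(1-4) by auto
  ultimately have "dist (dir_deriv w (dir_deriv v f) z) (dir_deriv v (dir_deriv w f) z) < e + e"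
    by (metis dist_commute dist_triangle_less_add)
  then show False by (simp add: e_def dist_real_def)
qed

lemma deriv2_eq:
  fixes g :: "real \<Rightarrow> real"
  assumes "\<forall>\<^sub>F t in nhds a. (g has_real_derivative g' t) (at t)"
    and "(g' has_real_derivative g'') (at a)"
  shows "(deriv ^^ 2) g a = g''"
proof -
  have "\<forall>\<^sub>F t in nhds a. deriv g t = g' t"
    using assms(1) by (rule eventually_mono) (rule DERIV_imp_deriv)
  then have "deriv (deriv g) a = deriv g' a" by (rule deriv_cong_ev) simp
  moreover have "(deriv ^^ 2) g a = deriv (deriv g) a" by (simp only: numeral_2_eq_2 funpow.simps o_def id_def)
  ultimately show ?thesis using DERIV_imp_deriv[OF assms(2)] by metis
qed

text \<open>Short pieces of curves are stretched to the parameter interval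
\<open>[-1, 1]\<close> on which the cross-curvature condition is stated; this is the effect on second derivatives.\<close>

lemma deriv2_affine_reparametrization:
  fixes F :: "real \<Rightarrow> real"
  assumes "\<epsilon> > 0" and ev: "\<forall>\<^sub>F t in nhds a. (F has_real_derivative F1 t) (at t)"
    and F2: "(F1 has_real_derivative F2) (at a)"
  shows "(deriv ^^ 2) (\<lambda>\<tau>. F (a + \<epsilon> * \<tau>)) 0 = \<epsilon>\<^sup>2 * F2"
proof (rule deriv2_eq)
  have aff: "((\<lambda>\<tau>. a + \<epsilon> * \<tau>) has_real_derivative \<epsilon>) (at \<tau>)" for \<tau>
    by (auto intro!: derivative_eq_intros)
  have "filterlim (\<lambda>\<tau>. a + \<epsilon> * \<tau>) (nhds (a + \<epsilon> * 0)) (nhds 0)"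
    by (intro tendsto_add tendsto_mult tendsto_const filterlim_ident)
  then have "filterlim (\<lambda>\<tau>. a + \<epsilon> * \<tau>) (nhds a) (nhds 0)" by simp
  from eventually_compose_filterlim[OF ev this]
  show "\<forall>\<^sub>F \<tau> in nhds 0. ((\<lambda>\<tau>. F (a + \<epsilon> * \<tau>)) has_real_derivative F1 (a + \<epsilon> * \<tau>) * \<epsilon>) (at \<tau>)"
    by (rule eventually_mono) (rule DERIV_chain2[OF _ aff])
  have "((\<lambda>\<tau>. F1 (a + \<epsilon> * \<tau>)) has_real_derivative F2 * \<epsilon>) (at 0)"
    by (rule DERIV_chain2[OF _ aff]) (simp add: F2)
  from DERIV_cmult_right[OF this, of \<epsilon>]
  show "((\<lambda>\<tau>. F1 (a + \<epsilon> * \<tau>) * \<epsilon>) has_real_derivative \<epsilon>\<^sup>2 * F2) (at 0)"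
    by (simp add: power2_eq_square mult_ac)
qed

section \<open>Segments seen through a diffeomorphism\<close>

lemma has_vector_derivative_iff_difference_quotient:
  fixes f :: "real \<Rightarrow> 'a::real_normed_vector"
  shows "(f has_vector_derivative D) (at t) \<longleftrightarrow> ((\<lambda>s. (f s - f t) /\<^sub>R (s - t)) \<longlongrightarrow> D) (at t)"
proof -
  have "(f has_vector_derivative D) (at t) \<longleftrightarrow>
      ((\<lambda>s. norm (f s - f t - (s - t) *\<^sub>R D) / norm (s - t)) \<longlongrightarrow> 0) (at t)"
    unfolding has_vector_derivative_def has_derivative_iff_norm
    by (simp add: bounded_linear_scaleR_left)
  also have "\<dots> \<longleftrightarrow> ((\<lambda>s. norm ((f s - f t) /\<^sub>R (s - t) - D)) \<longlongrightarrow> 0) (at t)"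
  proof (rule tendsto_cong)
    have "norm (f s - f t - (s - t) *\<^sub>R D) / norm (s - t) = norm ((f s - f t) /\<^sub>R (s - t) - D)"
      if "s \<noteq> t" for s
    proof -
      have "(f s - f t) /\<^sub>R (s - t) - D = (f s - f t - (s - t) *\<^sub>R D) /\<^sub>R (s - t)"
        using that by (simp add: scaleR_diff_right)
      then show ?thesis by (simp add: divide_inverse)
    qed
    then show "\<forall>\<^sub>F s in at t. norm (f s - f t - (s - t) *\<^sub>R D) / norm (s - t)
        = norm ((f s - f t) /\<^sub>R (s - t) - D)"
      by (auto simp: eventually_at_filter)
  qed
  also have "\<dots> \<longleftrightarrow> ((\<lambda>s. (f s - f t) /\<^sub>R (s - t)) \<longlongrightarrow> D) (at t)"
    using LIM_zero_iff[of "\<lambda>s. (f s - f t) /\<^sub>R (s - t)" D "at t"] by (simp add: tendsto_norm_zero_iff)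
  finally show ?thesis .
qed

text \<open>The inverse \<open>\<Phi>\<close> of \<open>G\<close> is only assumed to be continuously differentiable, so
the second derivative of the preimage \<open>y\<close> of a segment cannot be read off from it. Instead,
\<open>DG (y t)\<close> maps \<open>y'(t)\<close> to the constant vector \<open>q'\<close>. Hence the increment of \<open>y'\<close> from \<open>t\<close> to \<open>s\<close> is
the image under \<open>D\<Phi>\<close> of minus the increment of \<open>DG (y s)\<close> applied to the fixed vector \<open>y'(t)\<close>. The
latter has a derivative since \<open>G\<close> is twice differentiable, and for \<open>D\<Phi>\<close> continuity suffices.\<close>

lemma inverse_of_segment_twice_differentiable:
  fixes G :: "'a::euclidean_space \<Rightarrow> 'a"
  assumes S: "open S" and inj: "inj_on G (closure S)" and G: "Ck_on 2 S G"
    and inverse: "Ck_closure 1 (G ` S) (the_inv_into (closure S) G)"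
    and I: "open I" and seg: "\<And>t. t \<in> I \<Longrightarrow> q + t *\<^sub>R q' \<in> G ` S"
  obtains y y1 y2 where
    "y = (\<lambda>t. the_inv_into (closure S) G (q + t *\<^sub>R q'))"
    "\<And>t. t \<in> I \<Longrightarrow> y t \<in> S" "\<And>t. t \<in> I \<Longrightarrow> G (y t) = q + t *\<^sub>R q'"
    "\<And>t. t \<in> I \<Longrightarrow> (y has_vector_derivative y1 t) (at t)"
    "\<And>t. t \<in> I \<Longrightarrow> (y1 has_vector_derivative y2 t) (at t)"
    "\<And>t v. t \<in> I \<Longrightarrow> dir_deriv v G (y t) = q' \<Longrightarrow> y1 t = v"
proof -
  define \<Phi> where "\<Phi> = the_inv_into (closure S) G"
  define y where "y t = \<Phi> (q + t *\<^sub>R q')" for t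
  define M where "M t z = dir_deriv z \<Phi> (q + t *\<^sub>R q')" for t z
  have dG: "G differentiable (at x)" "dir_deriv w G differentiable (at x)" if "x \<in> S" for x w
    using G that by (simp_all add: numeral_2_eq_2)
  have contG: "continuous_on S G" using Ck_on_imp_continuous_on[OF G] .
  have "open (G ` S)"
    using invariance_of_domain[OF contG S] inj inj_on_subset closure_subset by blast
  then have Phi: "Ck_on (Suc 0) (G ` S) \<Phi>"
    using Ck_closure_imp_Ck_on inverse unfolding \<Phi>_def One_nat_def by blast
  have dPhi: "x \<in> G ` S \<Longrightarrow> \<Phi> differentiable (at x)" "continuous_on (G ` S) (dir_deriv w \<Phi>)" for x w
    using Ck_on_SucD(1)[OF Phi, of x] Ck_on_SucD(2)[OF Phi, of w] by simp_all
  have PhiG: "\<Phi> (G x) = x" if "x \<in> S" for x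
    unfolding \<Phi>_def using the_inv_into_f_f[OF inj] that closure_subset by blast
  have y_in: "y t \<in> S" and Gy: "G (y t) = q + t *\<^sub>R q'" if "t \<in> I" for t
    using seg[OF that] PhiG unfolding y_def by auto
  have MA: "M t (dir_deriv w G (y t)) = w" if "t \<in> I" for t w
  proof -
    have "(\<Phi> has_derivative (\<lambda>z. dir_deriv z \<Phi> (G (y t)))) (at (G (y t)))"
      using has_derivative_dir_deriv[OF dPhi(1)] y_in[OF that] by blast
    then have "((\<lambda>x. \<Phi> (G x)) has_derivative (\<lambda>w. dir_deriv (dir_deriv w G (y t)) \<Phi> (G (y t)))) (at (y t))"
      by (rule has_derivative_compose[OF has_derivative_dir_deriv[OF dG(1)[OF y_in[OF that]]]])
    then have "((\<lambda>x. x) has_derivative (\<lambda>w. dir_deriv (dir_deriv w G (y t)) \<Phi> (G (y t)))) (at (y t))"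
      by (rule has_derivative_transform_within_open[OF _ S y_in[OF that]]) (rule PhiG)
    from dir_deriv_eq[OF this, of w] dir_deriv_eq[OF has_derivative_ident, of w "y t"] show ?thesis
      unfolding M_def Gy[OF that] by simp
  qed
  have M_linear: "linear (M t)" if "t \<in> I" for t
    unfolding M_def using linear_dir_deriv[OF dPhi(1)[OF seg[OF that]]] .
  have y1: "(y has_vector_derivative M t q') (at t)" if "t \<in> I" for t
    unfolding y_def M_def
    by (rule dir_deriv_along_curve[where \<gamma> = "\<lambda>t. q + t *\<^sub>R q'", OF dPhi(1)[OF seg[OF that]]])
      (auto simp: has_vector_derivative_def intro!: derivative_eq_intros)
  have AM: "dir_deriv (M t q') G (y t) = q'" if "t \<in> I" for t
  proof -
    have "((\<lambda>t. q + t *\<^sub>R q') has_vector_derivative dir_deriv (M t q') G (y t)) (at t)"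
      by (rule has_vector_derivative_transform_within_open[OF
            dir_deriv_along_curve[OF dG(1)[OF y_in[OF that]] y1[OF that]] I that Gy])
    moreover have "((\<lambda>t. q + t *\<^sub>R q') has_vector_derivative q') (at t)"
      by (auto simp: has_vector_derivative_def intro!: derivative_eq_intros)
    ultimately show ?thesis by (rule vector_derivative_unique_at)
  qed
  have y2: "((\<lambda>t. M t q') has_vector_derivative
      - M t (dir_deriv (M t q') (dir_deriv (M t q') G) (y t))) (at t)" if t: "t \<in> I" for t
  proof -
    define a where "a s = dir_deriv (M t q') G (y s)" for s
    define B where "B = dir_deriv (M t q') (dir_deriv (M t q') G) (y t)"
    have "(a has_vector_derivative B) (at t)"
      unfolding a_def B_def by (rule dir_deriv_along_curve[OF dG(2)[OF y_in[OF t]] y1[OF t]])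
    then have a_lim: "((\<lambda>s. (a s - a t) /\<^sub>R (s - t)) \<longlongrightarrow> B) (at t)"
      by (simp add: has_vector_derivative_iff_difference_quotient)
    have M_lim: "((\<lambda>s. M s z) \<longlongrightarrow> M t z) (at t)" for z
    proof -
      have "continuous_on I (\<lambda>s. dir_deriv z \<Phi> (q + s *\<^sub>R q'))"
        by (rule continuous_on_compose2[OF dPhi(2)])
          (use seg in \<open>auto intro!: continuous_intros\<close>)
      then show ?thesis
        using I t unfolding M_def continuous_on_eq_continuous_at[OF I] isCont_def by blast
    qed
    have "((\<lambda>s. - (\<Sum>i\<in>Basis. (((a s - a t) /\<^sub>R (s - t)) \<bullet> i) *\<^sub>R M s i))
        \<longlongrightarrow> - (\<Sum>i\<in>Basis. (B \<bullet> i) *\<^sub>R M t i)) (at t)"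
      by (intro tendsto_intros M_lim a_lim)
    moreover have "- (\<Sum>i\<in>Basis. (B \<bullet> i) *\<^sub>R M t i) = - M t B"
      using linear_basis_expansion[OF M_linear[OF t]] by metis
    moreover have "- (\<Sum>i\<in>Basis. (((a s - a t) /\<^sub>R (s - t)) \<bullet> i) *\<^sub>R M s i)
        = (M s q' - M t q') /\<^sub>R (s - t)" if "s \<in> I" for s
    proof -
      have "(\<Sum>i\<in>Basis. (((a s - a t) /\<^sub>R (s - t)) \<bullet> i) *\<^sub>R M s i) = M s ((a s - a t) /\<^sub>R (s - t))"
        using linear_basis_expansion[OF M_linear[OF that]] by metis
      also have "\<dots> = (M s (a s) - M s (a t)) /\<^sub>R (s - t)"
        using M_linear[OF that] by (simp add: linear_scale linear_diff)
      also have "M s (a s) - M s (a t) = - (M s q' - M t q')"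
        using MA[OF that] AM[OF t] unfolding a_def by simp
      finally show ?thesis by (simp only: scaleR_minus_right minus_minus)
    qed
    then have "\<forall>\<^sub>F s in at t. - (\<Sum>i\<in>Basis. (((a s - a t) /\<^sub>R (s - t)) \<bullet> i) *\<^sub>R M s i)
        = (M s q' - M t q') /\<^sub>R (s - t)"
      using eventually_nhds_in_open[OF I t] by (auto simp: eventually_at_filter elim: eventually_mono)
    ultimately show ?thesis
      unfolding has_vector_derivative_iff_difference_quotient B_def[symmetric]
      using tendsto_cong by fastforce
  qed
  show ?thesis
  proof (rule that)
    show "y = (\<lambda>t. the_inv_into (closure S) G (q + t *\<^sub>R q'))"
      unfolding y_def \<Phi>_def ..
    show "M t q' = v" if "t \<in> I" "dir_deriv v G (y t) = q'" for t v
      using MA[OF that(1), of v] that(2) by simp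
  qed (use y_in Gy y1 y2 in auto)
qed

lemma open_segment_parameters:
  fixes T :: "'a::real_normed_vector set"
  assumes "open T" shows "open {t::real. q + t *\<^sub>R q' \<in> T}"
proof -
  have "continuous_on UNIV (\<lambda>t::real. q + t *\<^sub>R q')" by (intro continuous_intros)
  then have "open ((\<lambda>t::real. q + t *\<^sub>R q') -` T)" by (rule open_vimage[OF assms])
  then show ?thesis by (simp add: vimage_def)
qed

lemma convex_segment_parameters:
  assumes "convex T" shows "convex {t::real. q + t *\<^sub>R q' \<in> T}"
proof (rule convexI)
  fix s t u v :: real
  assume *: "s \<in> {t. q + t *\<^sub>R q' \<in> T}" "t \<in> {t. q + t *\<^sub>R q' \<in> T}" "0 \<le> u" "0 \<le> v" "u + v = 1"
  have "u *\<^sub>R (q + s *\<^sub>R q') + v *\<^sub>R (q + t *\<^sub>R q') \<in> T"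
    using * by (intro convexD[OF assms]) auto
  moreover have "u *\<^sub>R (q + s *\<^sub>R q') + v *\<^sub>R (q + t *\<^sub>R q')
      = (u + v) *\<^sub>R q + (u *\<^sub>R s + v *\<^sub>R t) *\<^sub>R q'"
    by (simp add: algebra_simps)
  ultimately show "u *\<^sub>R s + v *\<^sub>R t \<in> {t. q + t *\<^sub>R q' \<in> T}" using * by simp
qed

section \<open>Supports of b-convex functions\<close>

text \<open>This is the b-subdifferential of \<open>u\<close> at \<open>x\<close>; for bilinear \<open>b\<close> it is the subdifferential of
convex analysis.\<close>

definition supports :: "('a::topological_space \<Rightarrow> 'b \<Rightarrow> real) \<Rightarrow> 'a set \<Rightarrow> ('a \<Rightarrow> real) \<Rightarrow> 'a \<Rightarrow> 'b set" where
  "supports b X u x = {y. \<forall>z\<in>closure X. u x + b z y - b x y \<le> u z}"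

text \<open>Both transforms have the same form, so exchanging the two variables of the
kernel turns statements on agents into statements on products.\<close>

lemma bstar_convex_iff_b_convex: "bstar_convex b X Y v \<longleftrightarrow> b_convex (\<lambda>y x. b x y) Y X v"
  unfolding bstar_convex_def b_convex_def bstar_transform_def b_transform_def ..

lemma bstar_transform_ge:
  "x \<in> closure X \<Longrightarrow> ereal (b x y - u x) \<le> bstar_transform b X (\<lambda>z. ereal (u z)) y"
  unfolding bstar_transform_def by (rule SUP_upper2) auto

lemma bstar_transform_at_support:
  assumes "x \<in> closure X" "y \<in> supports b X u x"
  shows "bstar_transform b X (\<lambda>z. ereal (u z)) y = ereal (b x y - u x)"
proof (rule antisym)
  show "bstar_transform b X (\<lambda>z. ereal (u z)) y \<le> ereal (b x y - u x)"
    unfolding bstar_transform_def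
    by (rule SUP_least) (use assms in \<open>force simp: supports_def\<close>)
qed (rule bstar_transform_ge[OF assms(1)])

text \<open>A product nearly attaining the supremum in the transform is nearly supporting. This
also excludes infinite values of the conjugate price.\<close>

lemma supports_if_near_best:
  assumes "y \<in> closure Y" "x \<in> closure X"
    and "ereal e < ereal (b x y) - bstar_transform b X (\<lambda>z. ereal (u z)) y" and "z \<in> closure X"
  shows "e + b z y - b x y < u z"
proof -
  have "ereal (b z y - u z) \<le> bstar_transform b X (\<lambda>z. ereal (u z)) y"
    by (rule bstar_transform_ge[OF assms(4)])
  then show ?thesis using assms(3)
    by (cases "bstar_transform b X (\<lambda>z. ereal (u z)) y") auto
qed

text \<open>If one supporting product exists, the surplus of the agent under the conjugate
price menu is exactly \<open>u x\<close>, and a product attains it if and only if it supports \<open>u\<close>.\<close>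

lemma best_responses_eq_supports:
  assumes x: "x \<in> closure X" and "y0 \<in> closure Y" "y0 \<in> supports b X u x"
  shows "best_responses b Y (bstar_transform b X (\<lambda>z. ereal (u z))) x = closure Y \<inter> supports b X u x"
    (is "best_responses b Y ?v x = _")
proof (intro subset_antisym subsetI)
  fix y assume y: "y \<in> best_responses b Y ?v x"
  then have "ereal (b x y0) - ?v y0 \<le> ereal (b x y) - ?v y" using assms(2) by (simp add: best_responses_def)
  then have le: "ereal (u x) \<le> ereal (b x y) - ?v y"
    by (simp add: bstar_transform_at_support[OF x assms(3)])
  have "u x + b z y - b x y \<le> u z" if "z \<in> closure X" for z
    using le bstar_transform_ge[of z X b y u, OF that] by (cases "?v y") auto
  then show "y \<in> closure Y \<inter> supports b X u x"
    using y by (simp add: supports_def best_responses_def)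
next
  fix y assume y: "y \<in> closure Y \<inter> supports b X u x"
  have "ereal (b x z) - ?v z \<le> ereal (u x)" for z
    using bstar_transform_ge[of x X b z u, OF x] by (cases "?v z") auto
  then show "y \<in> best_responses b Y ?v x"
    using y bstar_transform_at_support[OF x, of y b u] by (simp add: best_responses_def)
qed

lemma b_convex_if_supports:
  assumes "\<And>x. x \<in> closure X \<Longrightarrow> \<exists>y\<in>closure Y. y \<in> supports b X u x"
  shows "b_convex b X Y u"
  unfolding b_convex_def
proof
  fix x assume x: "x \<in> closure X"
  let ?v = "bstar_transform b X (\<lambda>z. ereal (u z))"
  obtain y where y: "y \<in> closure Y" "y \<in> supports b X u x" using assms[OF x] by blast
  show "ereal (u x) = b_transform b Y ?v x"
  proof (rule antisym)
    show "ereal (u x) \<le> b_transform b Y ?v x"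
      unfolding b_transform_def
      by (rule SUP_upper2[OF y(1)]) (simp add: bstar_transform_at_support[OF x y(2)])
    show "b_transform b Y ?v x \<le> ereal (u x)"
      unfolding b_transform_def
    proof (rule SUP_least)
      fix z
      show "ereal (b x z) - ?v z \<le> ereal (u x)"
        using bstar_transform_ge[of x X b z u, OF x] by (cases "?v z") auto
    qed
  qed
qed

text \<open>The two variables enter symmetrically, so that the facts on supports apply to utilities
of agents and, with the variables exchanged, to the cost as a function of the product.\<close>

locale compact_kernel =
  fixes b :: "real^'n \<Rightarrow> real^'n \<Rightarrow> real" and X Y :: "(real^'n) set"
  assumes compact_X: "compact (closure X)" and compact_Y: "compact (closure Y)"
    and continuous_b: "continuous_on (closure X \<times> closure Y) (\<lambda>(x, y). b x y)"
begin

lemma tendsto_b: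
  assumes "xs \<longlonglongrightarrow> x" "ys \<longlonglongrightarrow> y" "x \<in> closure X" "y \<in> closure Y"
    "\<And>n. xs n \<in> closure X" "\<And>n. ys n \<in> closure Y"
  shows "(\<lambda>n. b (xs n) (ys n)) \<longlonglongrightarrow> b x y"
  using continuous_on_tendsto_compose[OF continuous_b tendsto_Pair[OF assms(1,2)]] assms(3-6) by simp

text \<open>Nearly optimal products accumulate, by compactness, at a product which supports \<open>u\<close>
exactly.\<close>

lemma b_convex_has_support:
  assumes u: "b_convex b X Y u" and x: "x \<in> closure X"
  shows "\<exists>y\<in>closure Y. y \<in> supports b X u x"
proof -
  let ?v = "bstar_transform b X (\<lambda>z. ereal (u z))"
  have "\<exists>y\<in>closure Y. ereal (u x - inverse (Suc n)) < ereal (b x y) - ?v y" for n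
  proof -
    have "ereal (u x - inverse (Suc n)) < ereal (u x)" by simp
    also have "\<dots> = (SUP y\<in>closure Y. ereal (b x y) - ?v y)"
      using u x unfolding b_convex_def b_transform_def by blast
    finally show ?thesis by (simp add: less_SUP_iff)
  qed
  then obtain ys where ys: "\<And>n. ys n \<in> closure Y"
    and near: "\<And>n. ereal (u x - inverse (Suc n)) < ereal (b x (ys n)) - ?v (ys n)" by metis
  then obtain y r where y: "y \<in> closure Y" and r: "strict_mono r" "(ys \<circ> r) \<longlonglongrightarrow> y"
    using compact_Y unfolding compact_def by meson
  have "u x + b z y - b x y \<le> u z" if z: "z \<in> closure X" for z
  proof (rule LIMSEQ_le_const2)
    have "(\<lambda>n. inverse (real (Suc n))) \<longlonglongrightarrow> 0" by (rule LIMSEQ_inverse_real_of_nat)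
    from LIMSEQ_subseq_LIMSEQ[OF this r(1)]
    have "(\<lambda>n. u x - inverse (real (Suc (r n))) + b z ((ys \<circ> r) n) - b x ((ys \<circ> r) n))
        \<longlonglongrightarrow> u x - 0 + b z y - b x y"
      by (intro tendsto_intros tendsto_b r x y z) (use ys in \<open>auto simp: o_def\<close>)
    then show "(\<lambda>n. u x - inverse (real (Suc (r n))) + b z ((ys \<circ> r) n) - b x ((ys \<circ> r) n))
        \<longlonglongrightarrow> u x + b z y - b x y" by simp
    have "u x - inverse (real (Suc (r n))) + b z ((ys \<circ> r) n) - b x ((ys \<circ> r) n) \<le> u z" for n
      using supports_if_near_best[OF ys x near z, of "r n"] by simp
    then show "\<exists>N. \<forall>n\<ge>N. u x - inverse (real (Suc (r n))) + b z ((ys \<circ> r) n) - b x ((ys \<circ> r) n) \<le> u z"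
      by blast
  qed
  then show ?thesis using y by (auto simp: supports_def)
qed

text \<open>A support at one point bounds \<open>u\<close> from below at the other by the oscillation of \<open>b\<close>, so
\<open>u\<close> inherits the modulus of continuity of \<open>b\<close>.\<close>

lemma b_convex_continuous:
  assumes u: "b_convex b X Y u"
  shows "continuous_on (closure X) u"
  unfolding continuous_on_iff
proof (intro ballI allI impI)
  fix x and e :: real assume x: "x \<in> closure X" and "e > 0"
  have "uniformly_continuous_on (closure X \<times> closure Y) (\<lambda>(x, y). b x y)"
    using compact_uniformly_continuous[OF continuous_b compact_Times[OF compact_X compact_Y]] .
  then obtain d where "d > 0" and d: "\<And>p q. p \<in> closure X \<times> closure Y \<Longrightarrow> q \<in> closure X \<times> closure Y \<Longrightarrow>
      dist q p < d \<Longrightarrow> dist (case q of (x, y) \<Rightarrow> b x y) (case p of (x, y) \<Rightarrow> b x y) < e"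
    using \<open>e > 0\<close> unfolding uniformly_continuous_on_def by metis
  have one_sided: "u z < u x + e" if x: "x \<in> closure X" and z: "z \<in> closure X" and zx: "dist z x < d" for x z
  proof -
    obtain y where y: "y \<in> closure Y" "y \<in> supports b X u z" using b_convex_has_support[OF u z] by blast
    have "dist (b z y) (b x y) < e"
      using d[of "(x, y)" "(z, y)"] x z zx y by (simp add: dist_Pair_Pair)
    moreover have "u z + b x y - b z y \<le> u x" using y(2) x by (simp add: supports_def)
    ultimately show ?thesis by (simp add: dist_real_def)
  qed
  show "\<exists>d>0. \<forall>x'\<in>closure X. dist x' x < d \<longrightarrow> dist (u x') (u x) < e"
  proof (intro exI conjI ballI impI)
    show "d > 0" by fact
    fix z assume "z \<in> closure X" "dist z x < d"
    then show "dist (u z) (u x) < e"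
      using one_sided[OF x, of z] one_sided[of z x, OF _ x] by (simp add: dist_commute dist_real_def abs_less_iff)
  qed
qed

lemma supports_limit:
  assumes u: "b_convex b X Y u" and "xs \<longlonglongrightarrow> x" "ys \<longlonglongrightarrow> y" "x \<in> closure X" "y \<in> closure Y"
    "\<And>n. xs n \<in> closure X" "\<And>n. ys n \<in> closure Y" and "\<And>n. ys n \<in> supports b X u (xs n)"
  shows "y \<in> supports b X u x"
  unfolding supports_def
proof (intro CollectI ballI)
  fix z assume z: "z \<in> closure X"
  have "(\<lambda>n. u (xs n)) \<longlonglongrightarrow> u x"
    using continuous_on_tendsto_compose[OF b_convex_continuous[OF u] assms(2,4)] assms(6) by simp
  then have "(\<lambda>n. u (xs n) + b z (ys n) - b (xs n) (ys n)) \<longlonglongrightarrow> u x + b z y - b x y"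
    by (intro tendsto_intros tendsto_b assms z)
  moreover have "\<exists>N. \<forall>n\<ge>N. u (xs n) + b z (ys n) - b (xs n) (ys n) \<le> u z"
    using assms(8) z by (simp add: supports_def)
  ultimately show "u x + b z y - b x y \<le> u z" by (rule LIMSEQ_le_const2)
qed

lemma swapped: "compact_kernel (\<lambda>y x. b x y) Y X"
proof
  have "continuous_on (closure Y \<times> closure X) (\<lambda>p. (\<lambda>(x, y). b x y) (snd p, fst p))"
    by (rule continuous_on_compose2[OF continuous_b]) (auto intro!: continuous_intros)
  then show "continuous_on (closure Y \<times> closure X) (\<lambda>(y, x). b x y)" by (simp add: case_prod_unfold)
qed (rule compact_X compact_Y)+

end

section \<open>Gradients of the preference function\<close>

text \<open>The gradients at boundary points are defined as limits; this identifies them with the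
values of any continuous extension.\<close>

lemma Lim_within_open_eq_extension:
  fixes F E :: "'a::euclidean_space \<Rightarrow> 'b::t2_space"
  assumes "open S" "continuous_on (closure S) E" "\<And>z. z \<in> S \<Longrightarrow> F z = E z" "x \<in> closure S"
  shows "Lim (at x within S) F = E x"
proof (rule tendsto_Lim)
  have "x islimpt S"
  proof (cases "x \<in> S")
    case True then show ?thesis using assms(1) interior_limit_point interior_open by metis
  next
    case False then show ?thesis using assms(4) by (simp add: closure_def)
  qed
  then show "\<not> trivial_limit (at x within S)" by (simp add: trivial_limit_within)
  have "(E \<longlongrightarrow> E x) (at x within S)"
    using assms(2,4) tendsto_within_subset[OF _ closure_subset] unfolding continuous_on_def by blast
  moreover have "\<forall>\<^sub>F z in at x within S. E z = F z"
    using assms(3) by (auto simp: eventually_at_filter)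
  ultimately show "(F \<longlongrightarrow> E x) (at x within S)" using Lim_transform_eventually by blast
qed

text \<open>In the applications \<open>J\<close> is the inclusion of one of the two factors of a product space, so that \<open>E\<close> is the gradient
in the corresponding variable.\<close>

lemma partial_gradient:
  fixes f :: "'c::euclidean_space \<Rightarrow> real" and J :: "'a::euclidean_space \<Rightarrow> 'c"
  assumes f': "\<And>z. z \<in> S \<Longrightarrow> (f has_derivative f' z) (at z)"
    and cont: "\<And>i. i \<in> Basis \<Longrightarrow> continuous_on (closure S) (\<lambda>z. f' z i)"
    and J: "linear J" "\<And>i. i \<in> Basis \<Longrightarrow> J i \<in> Basis"
  defines "E \<equiv> \<lambda>z. \<Sum>i\<in>Basis. f' z (J i) *\<^sub>R i"
  shows "continuous_on (closure S) E"
    and "z \<in> S \<Longrightarrow> f' z (J w) = w \<bullet> E z"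
proof -
  show "continuous_on (closure S) E"
    unfolding E_def by (intro continuous_intros cont J)
  assume "z \<in> S"
  have "linear (\<lambda>w. f' z (J w))"
    using linear_compose[OF J(1) has_derivative_linear[OF f'[OF \<open>z \<in> S\<close>]]] by (simp add: o_def)
  from linear_basis_expansion[OF this, of w]
  show "f' z (J w) = w \<bullet> E z" unfolding E_def by (simp add: inner_sum_right mult.commute)
qed

lemma the_GDERIV:
  assumes "GDERIV g x :> p"
  shows "(THE q. GDERIV g x :> q) = p"
proof (rule the_equality)
  show "GDERIV g x :> p" by (rule assms)
  fix q assume "GDERIV g x :> q"
  then have "(\<lambda>w. w \<bullet> q) = (\<lambda>w. w \<bullet> p)"
    using assms has_derivative_unique unfolding gderiv_def by blast
  then show "q = p" by (metis vector_eq_ldot)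
qed

locale smooth_kernel =
  fixes b :: "real^'n \<Rightarrow> real^'n \<Rightarrow> real" and X Y :: "(real^'n) set"
  assumes B0: "B0 b X Y"
begin

abbreviation f :: "(real^'n) \<times> (real^'n) \<Rightarrow> real" where "f \<equiv> \<lambda>(x, y). b x y"
abbreviation gx where "gx \<equiv> Dx b X Y"
abbreviation gy where "gy \<equiv> Dy b X Y"

lemma open_X: "open X" and open_Y: "open Y" and bounded_X: "bounded X" and bounded_Y: "bounded Y"
  using B0 by (simp_all add: B0_def)

lemma open_XY: "open (X \<times> Y)"
  using open_X open_Y by (rule open_Times)

lemma f_C4: "Ck_on 4 (X \<times> Y) f"
  using B0 Ck_closure_imp_Ck_on[OF open_XY] unfolding B0_def by blast

lemma dir_deriv_f_C3: "Ck_on 3 (X \<times> Y) (dir_deriv w f)"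
  and dir_deriv2_f_C2: "Ck_on 2 (X \<times> Y) (dir_deriv v (dir_deriv w f))"
proof -
  have "Ck_on (Suc 3) (X \<times> Y) f" using f_C4 by simp
  then show C3: "Ck_on 3 (X \<times> Y) (dir_deriv w f)" for w by (rule Ck_on_SucD(2))
  have "Ck_on (Suc 2) (X \<times> Y) (dir_deriv w f)" using C3 by simp
  then show "Ck_on 2 (X \<times> Y) (dir_deriv v (dir_deriv w f))" by (rule Ck_on_SucD(2))
qed

lemma f_C2: "Ck_on 2 (X \<times> Y) f"
  using Ck_on_mono[OF f_C4] by simp

lemma dir_deriv_f_C2: "Ck_on 2 (X \<times> Y) (dir_deriv w f)"
  using Ck_on_mono[OF dir_deriv_f_C3] by simp

lemma in_closure: "x \<in> X \<Longrightarrow> x \<in> closure X" "y \<in> Y \<Longrightarrow> y \<in> closure Y"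
  using closure_subset by auto

sublocale compact_kernel
proof
  have "Ck_closure (Suc 3) (X \<times> Y) f" using B0 unfolding B0_def by simp
  then show "continuous_on (closure X \<times> closure Y) f" unfolding Ck_closure.simps(2) closure_Times by blast
qed (use bounded_X bounded_Y in simp_all)

lemma gradients:
  shows continuous_gx: "continuous_on (closure X \<times> closure Y) (\<lambda>(x, y). gx x y)"
    and continuous_gy: "continuous_on (closure X \<times> closure Y) (\<lambda>(x, y). gy x y)"
    and dir_deriv_x: "\<And>x y w. x \<in> X \<Longrightarrow> y \<in> Y \<Longrightarrow> dir_deriv (w, 0) f (x, y) = w \<bullet> gx x y"
    and dir_deriv_y: "\<And>x y w. x \<in> X \<Longrightarrow> y \<in> Y \<Longrightarrow> dir_deriv (0, w) f (x, y) = w \<bullet> gy x y"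
proof -
  have "Ck_closure (Suc 3) (X \<times> Y) f" using B0 unfolding B0_def by simp
  then obtain f' where f': "\<And>z. z \<in> X \<times> Y \<Longrightarrow> (f has_derivative f' z) (at z)"
    and f'_C3: "\<And>i. i \<in> Basis \<Longrightarrow> Ck_closure 3 (X \<times> Y) (\<lambda>z. f' z i)"
    unfolding Ck_closure.simps(2) by blast
  then have cont: "continuous_on (closure (X \<times> Y)) (\<lambda>z. f' z i)" if "i \<in> Basis" for i
  proof -
    have "Ck_closure (Suc 2) (X \<times> Y) (\<lambda>z. f' z i)" using f'_C3[OF that] by simp
    then show ?thesis unfolding Ck_closure.simps(2) by blast
  qed
  have lin: "linear (\<lambda>w::real^'n. (w, 0::real^'n))" "linear (\<lambda>w::real^'n. (0::real^'n, w))"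
    by (auto intro!: linearI)
  define E1 where "E1 z = (\<Sum>i\<in>Basis. f' z (i, 0) *\<^sub>R i)" for z
  define E2 where "E2 z = (\<Sum>i\<in>Basis. f' z (0, i) *\<^sub>R i)" for z
  note E = partial_gradient[OF f' cont lin(1), folded E1_def] partial_gradient[OF f' cont lin(2), folded E2_def]
  have E: "continuous_on (closure (X \<times> Y)) E1" "continuous_on (closure (X \<times> Y)) E2"
    "\<And>z w. z \<in> X \<times> Y \<Longrightarrow> f' z (w, 0) = w \<bullet> E1 z"
    "\<And>z w. z \<in> X \<times> Y \<Longrightarrow> f' z (0, w) = w \<bullet> E2 z"
    using E by (auto simp: Basis_prod_def)
  have pd: "((\<lambda>z. b z y) has_derivative (\<lambda>w. f' (x, y) (w, 0))) (at x)"
       "((\<lambda>z. b x z) has_derivative (\<lambda>w. f' (x, y) (0, w))) (at y)" if "(x, y) \<in> X \<times> Y" for x y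
  proof -
    have "((\<lambda>z. (z, y)) has_derivative (\<lambda>w. (w, 0))) (at x)"
      "((\<lambda>z. (x, z)) has_derivative (\<lambda>w. (0, w))) (at y)"
      by (auto intro!: derivative_eq_intros)
    from this[THEN has_derivative_compose, OF f'[OF that]]
    show "((\<lambda>z. b z y) has_derivative (\<lambda>w. f' (x, y) (w, 0))) (at x)"
       "((\<lambda>z. b x z) has_derivative (\<lambda>w. f' (x, y) (0, w))) (at y)" by simp_all
  qed
  have G1: "(THE p. GDERIV (\<lambda>z. b z y) x :> p) = E1 (x, y)" if "(x, y) \<in> X \<times> Y" for x y
    using pd(1)[OF that] E(3)[OF that] by (intro the_GDERIV) (simp add: gderiv_def)
  have G2: "(THE p. GDERIV (\<lambda>z. b x z) y :> p) = E2 (x, y)" if "(x, y) \<in> X \<times> Y" for x y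
    using pd(2)[OF that] E(4)[OF that] by (intro the_GDERIV) (simp add: gderiv_def)
  have gxE: "gx x y = E1 (x, y)" if "x \<in> closure X" "y \<in> closure Y" for x y
    unfolding Dx_def by (rule Lim_within_open_eq_extension[OF open_XY E(1)])
      (use G1 that in \<open>auto simp: closure_Times\<close>)
  have gyE: "gy x y = E2 (x, y)" if "x \<in> closure X" "y \<in> closure Y" for x y
    unfolding Dy_def by (rule Lim_within_open_eq_extension[OF open_XY E(2)])
      (use G2 that in \<open>auto simp: closure_Times\<close>)
  show "continuous_on (closure X \<times> closure Y) (\<lambda>(x, y). gx x y)"
    using continuous_on_eq[OF E(1)[unfolded closure_Times], of "\<lambda>(x, y). gx x y"] gxE by auto
  show "continuous_on (closure X \<times> closure Y) (\<lambda>(x, y). gy x y)"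
    using continuous_on_eq[OF E(2)[unfolded closure_Times], of "\<lambda>(x, y). gy x y"] gyE by auto
  have in_cl: "x \<in> closure X" "y \<in> closure Y" if "x \<in> X" "y \<in> Y" for x y
    using that closure_subset by auto
  show "dir_deriv (w, 0) f (x, y) = w \<bullet> gx x y" if "x \<in> X" "y \<in> Y" for x y w
    using dir_deriv_eq[OF f'[of "(x, y)"]] E(3) gxE[OF in_cl[OF that]] that by simp
  show "dir_deriv (0, w) f (x, y) = w \<bullet> gy x y" if "x \<in> X" "y \<in> Y" for x y w
    using dir_deriv_eq[OF f'[of "(x, y)"]] E(4) gyE[OF in_cl[OF that]] that by simp
qed

text \<open>The gradient map has coordinates \<open>dir_deriv (i, 0) f\<close>, three times continuously differentiable;
two derivatives are what preimages of segments require.\<close>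

lemma gx_C2: assumes "x \<in> X" shows "Ck_on 2 Y (gx x)"
proof (rule Ck_on_cong[OF open_Y])
  have "Ck_on 2 Y (\<lambda>y. dir_deriv (i, 0) f ((x, 0) + (0, y)))" for i
    by (rule Ck_on_compose_affine[OF open_XY open_Y _ _ dir_deriv_f_C2])
      (use assms in \<open>auto intro: bounded_linear_Pair bounded_linear_zero bounded_linear_ident\<close>)
  then show "Ck_on 2 Y (\<lambda>y. \<Sum>i\<in>Basis. dir_deriv (i, 0) f ((x, 0) + (0, y)) *\<^sub>R i)"
    by (intro Ck_on_sum open_Y Ck_on_bounded_linear[OF _ bounded_linear_scaleR_left]) auto
  show "(\<Sum>i\<in>Basis. dir_deriv (i, 0) f ((x, 0) + (0, y)) *\<^sub>R i) = gx x y" if "y \<in> Y" for y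
    using dir_deriv_x[OF assms that] euclidean_representation[of "gx x y"] by (simp add: inner_commute)
qed

lemma gy_C2: assumes "y \<in> Y" shows "Ck_on 2 X (\<lambda>x. gy x y)"
proof (rule Ck_on_cong[OF open_X])
  have "Ck_on 2 X (\<lambda>x. dir_deriv (0, i) f ((0, y) + (x, 0)))" for i
    by (rule Ck_on_compose_affine[OF open_XY open_X _ _ dir_deriv_f_C2])
      (use assms in \<open>auto intro: bounded_linear_Pair bounded_linear_zero bounded_linear_ident\<close>)
  then show "Ck_on 2 X (\<lambda>x. \<Sum>i\<in>Basis. dir_deriv (0, i) f ((0, y) + (x, 0)) *\<^sub>R i)"
    by (intro Ck_on_sum open_X Ck_on_bounded_linear[OF _ bounded_linear_scaleR_left]) auto
  show "(\<Sum>i\<in>Basis. dir_deriv (0, i) f ((0, y) + (x, 0)) *\<^sub>R i) = gy x y" if "x \<in> X" for x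
    using dir_deriv_y[OF that assms] euclidean_representation[of "gy x y"] by (simp add: inner_commute)
qed

lemma derivatives_along_y:
  assumes "Ck_on 2 (X \<times> Y) g" "x \<in> X" "y t \<in> Y"
    and "(y has_vector_derivative y1 t) (at t)" "(y1 has_vector_derivative y2) (at t)"
  shows "((\<lambda>t. g (x, y t)) has_real_derivative dir_deriv (0, y1 t) g (x, y t)) (at t)"
    and "((\<lambda>t. dir_deriv (0, y1 t) g (x, y t)) has_real_derivative
      dir_deriv (0, y2) g (x, y t) + dir_deriv (0, y1 t) (dir_deriv (0, y1 t) g) (x, y t)) (at t)"
proof -
  have d: "((\<lambda>t. (x, y t)) has_vector_derivative (0, y1 t)) (at t)"
    "((\<lambda>t. (0::real^'n, y1 t)) has_vector_derivative (0, y2)) (at t)"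
    using assms(4,5) by (auto intro!: has_vector_derivative_Pair)
  have "g differentiable (at (x, y t))"
    by (rule Ck_on_SucD(1)[OF assms(1)[unfolded numeral_2_eq_2]]) (use assms(2,3) in simp)
  from dir_deriv_along_curve[OF this d(1)]
  show "((\<lambda>t. g (x, y t)) has_real_derivative dir_deriv (0, y1 t) g (x, y t)) (at t)"
    by (simp add: has_real_derivative_iff_has_vector_derivative)
  show "((\<lambda>t. dir_deriv (0, y1 t) g (x, y t)) has_real_derivative
      dir_deriv (0, y2) g (x, y t) + dir_deriv (0, y1 t) (dir_deriv (0, y1 t) g) (x, y t)) (at t)"
    using second_dir_deriv_along_curve[OF open_XY assms(1) _ d(1) d(2)] assms(2,3)
    by (simp add: has_real_derivative_iff_has_vector_derivative)
qed

lemma derivatives_along_x: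
  assumes "Ck_on 2 (X \<times> Y) g" "x t \<in> X" "y \<in> Y"
    and "(x has_vector_derivative x1 t) (at t)" "(x1 has_vector_derivative x2) (at t)"
  shows "((\<lambda>t. g (x t, y)) has_real_derivative dir_deriv (x1 t, 0) g (x t, y)) (at t)"
    and "((\<lambda>t. dir_deriv (x1 t, 0) g (x t, y)) has_real_derivative
      dir_deriv (x2, 0) g (x t, y) + dir_deriv (x1 t, 0) (dir_deriv (x1 t, 0) g) (x t, y)) (at t)"
proof -
  have d: "((\<lambda>t. (x t, y)) has_vector_derivative (x1 t, 0)) (at t)"
    "((\<lambda>t. (x1 t, 0::real^'n)) has_vector_derivative (x2, 0)) (at t)"
    using assms(4,5) by (auto intro!: has_vector_derivative_Pair)
  have "g differentiable (at (x t, y))"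
    by (rule Ck_on_SucD(1)[OF assms(1)[unfolded numeral_2_eq_2]]) (use assms(2,3) in simp)
  from dir_deriv_along_curve[OF this d(1)]
  show "((\<lambda>t. g (x t, y)) has_real_derivative dir_deriv (x1 t, 0) g (x t, y)) (at t)"
    by (simp add: has_real_derivative_iff_has_vector_derivative)
  show "((\<lambda>t. dir_deriv (x1 t, 0) g (x t, y)) has_real_derivative
      dir_deriv (x2, 0) g (x t, y) + dir_deriv (x1 t, 0) (dir_deriv (x1 t, 0) g) (x t, y)) (at t)"
    using second_dir_deriv_along_curve[OF open_XY assms(1) _ d(1) d(2)] assms(2,3)
    by (simp add: has_real_derivative_iff_has_vector_derivative)
qed

end

section \<open>Non-negative cross-curvature and intermediate products\<close>

text \<open>In what follows a curve of products \<open>y\<close> is called a segment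
seen from a type \<open>x\<close> if \<open>D_x b (x, y t)\<close> is affine in \<open>t\<close>, and symmetrically for curves of types.\<close>

locale cross_curved_kernel = smooth_kernel b X Y
  for b :: "real^'n \<Rightarrow> real^'n \<Rightarrow> real" and X Y +
  assumes B1: "B1 b X Y" and B2: "B2 b X Y" and B3: "B3 b X Y" and X_nonempty: "X \<noteq> {}"
    and Y_nonempty: "Y \<noteq> {}"
begin

lemma gx_diffeo: "x \<in> closure X \<Longrightarrow> diffeo_onto_range Y (gx x)"
  and gy_diffeo: "y \<in> closure Y \<Longrightarrow> diffeo_onto_range X (\<lambda>x. gy x y)"
  using B1 X_nonempty Y_nonempty closure_subset unfolding B1_def by blast+

lemma inj_gx: "x \<in> closure X \<Longrightarrow> inj_on (gx x) (closure Y)"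
  using gx_diffeo unfolding diffeo_onto_range_def by blast

lemma inj_gy: "y \<in> closure Y \<Longrightarrow> inj_on (\<lambda>x. gy x y) (closure X)"
  using gy_diffeo unfolding diffeo_onto_range_def by blast

lemma convex_gx: "x \<in> closure X \<Longrightarrow> convex (gx x ` Y)"
  and convex_gy: "y \<in> closure Y \<Longrightarrow> convex ((\<lambda>x. gy x y) ` X)"
  using B2 X_nonempty Y_nonempty closure_subset unfolding B2_def by blast+

lemma open_gx: assumes "x \<in> X" shows "open (gx x ` Y)"
  by (rule invariance_of_domain[OF Ck_on_imp_continuous_on[OF gx_C2[OF assms]] open_Y])
    (use inj_gx[OF in_closure(1)[OF assms]] inj_on_subset closure_subset in blast)

lemma open_gy: assumes "y \<in> Y" shows "open ((\<lambda>x. gy x y) ` X)"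
  by (rule invariance_of_domain[OF Ck_on_imp_continuous_on[OF gy_C2[OF assms]] open_X])
    (use inj_gy[OF in_closure(2)[OF assms]] inj_on_subset closure_subset in blast)

lemma y_segment:
  assumes "x \<in> X" "open I" "\<And>t. t \<in> I \<Longrightarrow> q + t *\<^sub>R q' \<in> gx x ` Y"
  obtains y y1 y2 where
    "\<And>t. t \<in> I \<Longrightarrow> y t \<in> Y" "\<And>t. t \<in> I \<Longrightarrow> gx x (y t) = q + t *\<^sub>R q'"
    "\<And>t. t \<in> I \<Longrightarrow> (y has_vector_derivative y1 t) (at t)"
    "\<And>t. t \<in> I \<Longrightarrow> (y1 has_vector_derivative y2 t) (at t)"
    "\<And>t v. t \<in> I \<Longrightarrow> dir_deriv v (gx x) (y t) = q' \<Longrightarrow> y1 t = v"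
proof -
  have inverse: "Ck_closure 1 (gx x ` Y) (the_inv_into (closure Y) (gx x))"
    using gx_diffeo[OF in_closure(1)[OF assms(1)]] unfolding diffeo_onto_range_def by blast
  show ?thesis
    by (rule inverse_of_segment_twice_differentiable[OF open_Y inj_gx[OF in_closure(1)[OF assms(1)]]
          gx_C2[OF assms(1)] inverse assms(2,3)]) (assumption, rule that)
qed

lemma x_segment:
  assumes "y \<in> Y" "open I" "\<And>t. t \<in> I \<Longrightarrow> p + t *\<^sub>R p' \<in> (\<lambda>x. gy x y) ` X"
  obtains x x1 x2 where
    "\<And>t. t \<in> I \<Longrightarrow> x t \<in> X" "\<And>t. t \<in> I \<Longrightarrow> gy (x t) y = p + t *\<^sub>R p'"
    "\<And>t. t \<in> I \<Longrightarrow> (x has_vector_derivative x1 t) (at t)"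
    "\<And>t. t \<in> I \<Longrightarrow> (x1 has_vector_derivative x2 t) (at t)"
proof -
  have inverse: "Ck_closure 1 ((\<lambda>x. gy x y) ` X) (the_inv_into (closure X) (\<lambda>x. gy x y))"
    using gy_diffeo[OF in_closure(2)[OF assms(1)]] unfolding diffeo_onto_range_def by blast
  show ?thesis
    by (rule inverse_of_segment_twice_differentiable[OF open_X inj_gy[OF in_closure(2)[OF assms(1)]]
          gy_C2[OF assms(1)] inverse assms(2,3)]) (assumption, rule that)
qed

text \<open>The cross-curvature condition speaks of two segments seen from each other's base point. Write
\<open>y\<close> for the curve of products through \<open>y0\<close> with velocity \<open>v\<close>. Then the second \<open>t\<close>-derivative of
\<open>b (x s) (y t)\<close> at \<open>y0\<close> is \<open>h (x s, y0)\<close> plus \<open>D_y b (x s, y0)\<close> applied to the acceleration of \<open>y\<close>.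
The last term is affine in \<open>s\<close>, because the types form a segment seen from \<open>y0\<close>; two derivatives in
\<open>s\<close> remove it. What remains no longer depends on the curve of products, so that the base
type \<open>x s0\<close> can be moved along the whole segment, with a new curve of products for each \<open>s0\<close>.\<close>

lemma hessian_convex_along_x_segment:
  fixes v :: "real^'n"
  assumes y0: "y0 \<in> Y" and I: "open I"
    and x: "\<And>s. s \<in> I \<Longrightarrow> x s \<in> X" "\<And>s. s \<in> I \<Longrightarrow> gy (x s) y0 = p + s *\<^sub>R p'"
    and x': "\<And>s. s \<in> I \<Longrightarrow> (x has_vector_derivative x1 s) (at s)"
    and x'': "\<And>s. s \<in> I \<Longrightarrow> (x1 has_vector_derivative x2 s) (at s)"
    and s0: "s0 \<in> I"
  defines "h \<equiv> dir_deriv (0, v) (dir_deriv (0, v) f)"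
  shows "dir_deriv (x2 s0, 0) h (x s0, y0)
    + dir_deriv (x1 s0, 0) (dir_deriv (x1 s0, 0) h) (x s0, y0) \<ge> 0" (is "?H2 \<ge> 0")
proof -
  let ?T = "gx (x s0) ` Y"
  define q0 where "q0 = gx (x s0) y0"
  \<comment> \<open>This velocity in gradient coordinates gives the curve of products the velocity \<open>v\<close> at \<open>y0\<close>.\<close>
  define q' where "q' = dir_deriv v (gx (x s0)) y0"
  define J where "J = {t. q0 + t *\<^sub>R q' \<in> ?T}"
  have xs0: "x s0 \<in> X" using x(1) s0 .
  have J: "open J" unfolding J_def by (rule open_segment_parameters[OF open_gx[OF xs0]])
  have "0 \<in> J" using y0 by (simp add: J_def q0_def)
  obtain y y1 y2 where y: "\<And>t. t \<in> J \<Longrightarrow> y t \<in> Y" "\<And>t. t \<in> J \<Longrightarrow> gx (x s0) (y t) = q0 + t *\<^sub>R q'"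
    and y': "\<And>t. t \<in> J \<Longrightarrow> (y has_vector_derivative y1 t) (at t)"
    and y'': "\<And>t. t \<in> J \<Longrightarrow> (y1 has_vector_derivative y2 t) (at t)"
    and y1: "\<And>t v. t \<in> J \<Longrightarrow> dir_deriv v (gx (x s0)) (y t) = q' \<Longrightarrow> y1 t = v"
    by (rule y_segment[OF xs0 J, of q0 q'], simp add: J_def, rule that)
  have y_0: "y 0 = y0"
    using inj_onD[OF inj_gx[OF in_closure(1)[OF xs0]]] y[OF \<open>0 \<in> J\<close>] y0 in_closure(2)
    unfolding q0_def by simp
  have y1_0: "y1 0 = v" using y1[OF \<open>0 \<in> J\<close>] unfolding y_0 q'_def by simp
  have h_C2: "Ck_on 2 (X \<times> Y) h" unfolding h_def by (rule dir_deriv2_f_C2)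
  obtain \<epsilon>1 where \<epsilon>1: "\<epsilon>1 > 0" "cball s0 \<epsilon>1 \<subseteq> I" using I s0 open_contains_cball by blast
  obtain \<epsilon>2 where \<epsilon>2: "\<epsilon>2 > 0" "cball 0 \<epsilon>2 \<subseteq> J" using J \<open>0 \<in> J\<close> open_contains_cball by blast
  \<comment> \<open>Both curves are slowed down so that they are defined on all of \<open>[-1, 1]\<close>.\<close>
  define \<epsilon> where "\<epsilon> = min \<epsilon>1 \<epsilon>2"
  have "\<epsilon> > 0" using \<epsilon>1 \<epsilon>2 by (simp add: \<epsilon>_def)
  have abs_le: "\<bar>\<epsilon> * t\<bar> \<le> \<epsilon>" if "t \<in> {-1..1}" for t
    using that \<open>\<epsilon> > 0\<close> by (simp add: abs_mult mult_left_le abs_le_iff)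
  have sI: "s0 + \<epsilon> * t \<in> I" and tJ: "\<epsilon> * t \<in> J" if "t \<in> {-1..1}" for t
  proof -
    have "s0 + \<epsilon> * t \<in> cball s0 \<epsilon>1" "\<epsilon> * t \<in> cball 0 \<epsilon>2"
      using abs_le[OF that] by (auto simp: dist_real_def \<epsilon>_def)
    then show "s0 + \<epsilon> * t \<in> I" "\<epsilon> * t \<in> J" using \<epsilon>1 \<epsilon>2 by blast+
  qed
  have B3': "(\<forall>t\<in>{-1..1}. x t \<in> closure X \<and> y t \<in> closure Y) \<Longrightarrow>
     (\<exists>p p' q q'. \<forall>t\<in>{-1..1}. gy (x t) (y 0) = p + t *\<^sub>R p' \<and> gx (x 0) (y t) = q + t *\<^sub>R q') \<Longrightarrow>
     (deriv ^^ 2) (\<lambda>s. (deriv ^^ 2) (\<lambda>t. b (x s) (y t)) 0) 0 \<ge> 0" for x y :: "real \<Rightarrow> real^'n"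
    using B3 unfolding B3_def by blast
  have nonneg: "(deriv ^^ 2) (\<lambda>\<sigma>. (deriv ^^ 2) (\<lambda>\<tau>. b (x (s0 + \<epsilon> * \<sigma>)) (y (\<epsilon> * \<tau>))) 0) 0 \<ge> 0"
  proof (rule B3'[of "\<lambda>\<sigma>. x (s0 + \<epsilon> * \<sigma>)" "\<lambda>\<tau>. y (\<epsilon> * \<tau>)"])
    show "\<forall>t\<in>{-1..1}. x (s0 + \<epsilon> * t) \<in> closure X \<and> y (\<epsilon> * t) \<in> closure Y"
      using sI tJ x(1) y(1) in_closure by blast
    have "gy (x (s0 + \<epsilon> * t)) (y (\<epsilon> * 0)) = (p + s0 *\<^sub>R p') + t *\<^sub>R (\<epsilon> *\<^sub>R p')"
      "gx (x (s0 + \<epsilon> * 0)) (y (\<epsilon> * t)) = q0 + t *\<^sub>R (\<epsilon> *\<^sub>R q')" if "t \<in> {-1..1}" for t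
      using x(2)[OF sI[OF that]] y(2)[OF tJ[OF that]] by (simp_all add: y_0 algebra_simps)
    then show "\<exists>p p' q q'. \<forall>t\<in>{-1..1}. gy (x (s0 + \<epsilon> * t)) (y (\<epsilon> * 0)) = p + t *\<^sub>R p' \<and>
        gx (x (s0 + \<epsilon> * 0)) (y (\<epsilon> * t)) = q + t *\<^sub>R q'" by blast
  qed
  define w where "w = y2 0"
  \<comment> \<open>The inner second derivative as a function of the type; its first summand is affine.\<close>
  define N where "N s = \<epsilon>\<^sup>2 * (w \<bullet> (p + s *\<^sub>R p') + h (x s, y0))" for s
  have inner: "(deriv ^^ 2) (\<lambda>\<tau>. b (x s) (y (\<epsilon> * \<tau>))) 0 = N s" if "s \<in> I" for s
  proof -
    have "(deriv ^^ 2) (\<lambda>\<tau>. f (x s, y (0 + \<epsilon> * \<tau>))) 0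
      = \<epsilon>\<^sup>2 * (dir_deriv (0, y2 0) f (x s, y 0) + dir_deriv (0, y1 0) (dir_deriv (0, y1 0) f) (x s, y 0))"
    proof (rule deriv2_affine_reparametrization[OF \<open>\<epsilon> > 0\<close>])
      show "\<forall>\<^sub>F t in nhds 0. ((\<lambda>t. f (x s, y t)) has_real_derivative dir_deriv (0, y1 t) f (x s, y t)) (at t)"
        using eventually_nhds_in_open[OF J \<open>0 \<in> J\<close>]
        by (rule eventually_mono) (use derivatives_along_y(1)[OF f_C2 x(1)[OF that] y(1) y' y''] in blast)
      show "((\<lambda>t. dir_deriv (0, y1 t) f (x s, y t)) has_real_derivative
          dir_deriv (0, y2 0) f (x s, y 0) + dir_deriv (0, y1 0) (dir_deriv (0, y1 0) f) (x s, y 0)) (at 0)"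
        using derivatives_along_y(2)[OF f_C2 x(1)[OF that] y(1) y' y''] \<open>0 \<in> J\<close> by blast
    qed
    then show ?thesis
      using dir_deriv_y[OF x(1)[OF that] y0] x(2)[OF that]
      by (simp add: y_0 y1_0 N_def w_def h_def)
  qed
  have "\<forall>\<^sub>F \<sigma> in nhds 0. (deriv ^^ 2) (\<lambda>\<tau>. b (x (s0 + \<epsilon> * \<sigma>)) (y (\<epsilon> * \<tau>))) 0 = N (s0 + \<epsilon> * \<sigma>)"
    using eventually_nhds_in_open[of "{-1<..<1::real}" 0]
    by (auto elim!: eventually_mono intro!: inner sI)
  from higher_deriv_cong_ev[OF this refl, of 2] nonneg
  have "0 \<le> (deriv ^^ 2) (\<lambda>\<sigma>. N (s0 + \<epsilon> * \<sigma>)) 0" by simp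
  also have "\<dots> = \<epsilon>\<^sup>2 * (\<epsilon>\<^sup>2 * ?H2)"
  proof (rule deriv2_affine_reparametrization[OF \<open>\<epsilon> > 0\<close>])
    have "(N has_real_derivative \<epsilon>\<^sup>2 * (w \<bullet> p' + dir_deriv (x1 s, 0) h (x s, y0))) (at s)"
      if "s \<in> I" for s
      unfolding N_def
    proof (rule DERIV_cmult[OF DERIV_add])
      show "((\<lambda>s. w \<bullet> (p + s *\<^sub>R p')) has_real_derivative w \<bullet> p') (at s)"
        by (auto intro!: derivative_eq_intros simp: inner_add_right)
      show "((\<lambda>s. h (x s, y0)) has_real_derivative dir_deriv (x1 s, 0) h (x s, y0)) (at s)"
        by (rule derivatives_along_x(1)[OF h_C2 x(1)[OF that] y0 x'[OF that] x''[OF that]])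
    qed
    then show "\<forall>\<^sub>F s in nhds s0. (N has_real_derivative
        \<epsilon>\<^sup>2 * (w \<bullet> p' + dir_deriv (x1 s, 0) h (x s, y0))) (at s)"
      using eventually_nhds_in_open[OF I s0] by (auto elim: eventually_mono)
    show "((\<lambda>s. \<epsilon>\<^sup>2 * (w \<bullet> p' + dir_deriv (x1 s, 0) h (x s, y0))) has_real_derivative \<epsilon>\<^sup>2 * ?H2) (at s0)"
      using DERIV_cmult[OF DERIV_add[OF DERIV_const derivatives_along_x(2)[where x = x and y = y0,
              OF h_C2 x(1)[OF s0] y0 x'[OF s0] x''[OF s0]]], of "\<epsilon>\<^sup>2" "w \<bullet> p'"] by simp
  qed
  finally show ?thesis using \<open>\<epsilon> > 0\<close> by (simp add: zero_le_mult_iff)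
qed

text \<open>Let \<open>x\<close> be the segment of types from \<open>x0\<close> to \<open>x1\<close> seen from \<open>y t\<close>, with initial
velocity \<open>\<xi>\<close> and displacement \<open>p' = D_y b (x1, y t) - D_y b (x0, y t)\<close>. Let \<open>w\<close> be the acceleration
of \<open>y\<close> and \<open>H s\<close> the Hessian of \<open>b (x s)\<close> at \<open>y t\<close> in the direction of its velocity. Then the second
derivative of the difference is \<open>w \<bullet> p' + H 1 - H 0\<close>. On the other hand \<open>\<xi> \<bullet> D_x b (x0, y t)\<close> is affine in
\<open>t\<close>, and its vanishing second derivative reads \<open>w \<bullet> p' + H'(0) = 0\<close> after interchanging derivatives.
So the claim is that the convex function \<open>H\<close> lies above its tangent at \<open>0\<close>.\<close>

lemma b_difference_convex_along_y_segment:
  assumes x0: "x0 \<in> X" and x1: "x1 \<in> X" and I: "open I"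
    and y: "\<And>t. t \<in> I \<Longrightarrow> y t \<in> Y" "\<And>t. t \<in> I \<Longrightarrow> gx x0 (y t) = q + t *\<^sub>R q'"
    and y': "\<And>t. t \<in> I \<Longrightarrow> (y has_vector_derivative y1 t) (at t)"
    and y'': "\<And>t. t \<in> I \<Longrightarrow> (y1 has_vector_derivative y2 t) (at t)"
    and t: "t \<in> I"
  defines "F2 \<equiv> \<lambda>x. dir_deriv (0, y2 t) f (x, y t) + dir_deriv (0, y1 t) (dir_deriv (0, y1 t) f) (x, y t)"
  shows "F2 x1 - F2 x0 \<ge> 0"
proof -
  define y0 where "y0 = y t"
  define v where "v = y1 t"
  define w where "w = y2 t"
  define h where "h = dir_deriv (0, v) (dir_deriv (0, v) f)"
  define p where "p = gy x0 y0"
  define p' where "p' = gy x1 y0 - gy x0 y0"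
  define S where "S = {s. p + s *\<^sub>R p' \<in> (\<lambda>x. gy x y0) ` X}"
  have y0: "y0 \<in> Y" unfolding y0_def by (rule y(1)[OF t])
  have S: "open S" "convex S"
    unfolding S_def by (rule open_segment_parameters[OF open_gy[OF y0]],
        rule convex_segment_parameters[OF convex_gy[OF in_closure(2)[OF y0]]])
  have "0 \<in> S" "1 \<in> S" using x0 x1 by (auto simp: S_def p_def p'_def)
  obtain x x' x'' where x: "\<And>s. s \<in> S \<Longrightarrow> x s \<in> X" "\<And>s. s \<in> S \<Longrightarrow> gy (x s) y0 = p + s *\<^sub>R p'"
    and x': "\<And>s. s \<in> S \<Longrightarrow> (x has_vector_derivative x' s) (at s)"
    and x'': "\<And>s. s \<in> S \<Longrightarrow> (x' has_vector_derivative x'' s) (at s)"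
    by (rule x_segment[OF y0 S(1), of p p'], simp add: S_def, rule that)
  have x_0: "x 0 = x0" and x_1: "x 1 = x1"
    using inj_onD[OF inj_gy[OF in_closure(2)[OF y0]]] x[OF \<open>0 \<in> S\<close>] x[OF \<open>1 \<in> S\<close>] x0 x1 in_closure(1)
    by (simp_all add: p_def p'_def)
  have h_C2: "Ck_on 2 (X \<times> Y) h" unfolding h_def by (rule dir_deriv2_f_C2)
  define H where "H s = h (x s, y0)" for s
  have H1: "(H has_real_derivative dir_deriv (x' s, 0) h (x s, y0)) (at s)" if "s \<in> S" for s
    unfolding H_def by (rule derivatives_along_x(1)[OF h_C2 x(1)[OF that] y0 x'[OF that] x''[OF that]])
  \<comment> \<open>\<open>S\<close> is an open interval containing \<open>[0, 1]\<close>, so the tangent at \<open>0\<close> is two-sided.\<close>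
  have "convex_on S H"
  proof (rule f''_ge0_imp_convex[OF S(2) H1])
    show "((\<lambda>s. dir_deriv (x' s, 0) h (x s, y0)) has_real_derivative
      dir_deriv (x'' s, 0) h (x s, y0) + dir_deriv (x' s, 0) (dir_deriv (x' s, 0) h) (x s, y0)) (at s)"
      if "s \<in> S" for s
      by (rule derivatives_along_x(2)[where x = x, OF h_C2 x(1)[OF that] y0 x'[OF that] x''[OF that]])
    show "0 \<le> dir_deriv (x'' s, 0) h (x s, y0) + dir_deriv (x' s, 0) (dir_deriv (x' s, 0) h) (x s, y0)"
      if "s \<in> S" for s
      unfolding h_def by (rule hessian_convex_along_x_segment[OF y0 S(1) x x' x'' that])
  qed
  then have tangent: "H 1 - H 0 \<ge> dir_deriv (x' 0, 0) h (x0, y0) * (1 - 0)"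
    using convex_on_imp_above_tangent[OF _ convex_connected[OF S(2)], of H 0 1]
      H1[OF \<open>0 \<in> S\<close>] \<open>0 \<in> S\<close> \<open>1 \<in> S\<close> S(1)
    by (simp add: interior_open x_0 has_field_derivative_at_within)
  define \<xi> where "\<xi> = x' 0"
  have z0: "(x0, y0) \<in> X \<times> Y" using x0 y0 by simp
  have "dir_deriv (\<xi>, 0) h (x0, y0) = dir_deriv (0, v) (dir_deriv (\<xi>, 0) (dir_deriv (0, v) f)) (x0, y0)"
    unfolding h_def by (rule dir_deriv_commute[OF open_XY z0 dir_deriv_f_C2])
  also have "\<dots> = dir_deriv (0, v) (dir_deriv (0, v) (dir_deriv (\<xi>, 0) f)) (x0, y0)"
  proof (rule dir_deriv_cong[OF open_XY z0])
    show "dir_deriv (\<xi>, 0) (dir_deriv (0, v) f) z = dir_deriv (0, v) (dir_deriv (\<xi>, 0) f) z"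
      if "z \<in> X \<times> Y" for z
      by (rule dir_deriv_commute[OF open_XY that f_C2])
    show "dir_deriv (\<xi>, 0) (dir_deriv (0, v) f) differentiable at (x0, y0)"
      by (rule Ck_on_SucD(1)[OF dir_deriv2_f_C2[unfolded numeral_2_eq_2] z0])
  qed
  finally have commuted: "dir_deriv (\<xi>, 0) h (x0, y0)
      = dir_deriv (0, v) (dir_deriv (0, v) (dir_deriv (\<xi>, 0) f)) (x0, y0)" .
  have mixed: "dir_deriv (0, w) (dir_deriv (\<xi>, 0) f) (x0, y0) = w \<bullet> p'"
  proof -
    have "((\<lambda>s. dir_deriv (0, w) f (x s, y0)) has_real_derivative
        dir_deriv (x' 0, 0) (dir_deriv (0, w) f) (x 0, y0)) (at 0)"
      by (rule derivatives_along_x(1)[OF dir_deriv_f_C2 x(1) y0 x' x'']) (rule \<open>0 \<in> S\<close>)+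
    moreover have "((\<lambda>s. dir_deriv (0, w) f (x s, y0)) has_real_derivative w \<bullet> p') (at 0)"
    proof (rule has_field_derivative_transform_within_open[OF _ S(1) \<open>0 \<in> S\<close>])
      show "((\<lambda>s. w \<bullet> (p + s *\<^sub>R p')) has_real_derivative w \<bullet> p') (at 0)"
        by (auto intro!: derivative_eq_intros simp: inner_add_right)
      show "w \<bullet> (p + s *\<^sub>R p') = dir_deriv (0, w) f (x s, y0)" if "s \<in> S" for s
        using dir_deriv_y[OF x(1)[OF that] y0] x(2)[OF that] by simp
    qed
    ultimately have "dir_deriv (\<xi>, 0) (dir_deriv (0, w) f) (x0, y0) = w \<bullet> p'"
      unfolding \<xi>_def x_0[symmetric] by (rule DERIV_unique)
    then show ?thesis using dir_deriv_commute[OF open_XY z0 f_C2] by metis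
  qed
  have affine: "dir_deriv (0, w) (dir_deriv (\<xi>, 0) f) (x0, y0)
      + dir_deriv (0, v) (dir_deriv (0, v) (dir_deriv (\<xi>, 0) f)) (x0, y0) = 0"
  proof -
    let ?g = "dir_deriv (\<xi>, 0) f"
    have first: "dir_deriv (0, y1 s) ?g (x0, y s) = \<xi> \<bullet> q'" if "s \<in> I" for s
    proof (rule DERIV_unique)
      show "((\<lambda>s. ?g (x0, y s)) has_real_derivative dir_deriv (0, y1 s) ?g (x0, y s)) (at s)"
        by (rule derivatives_along_y(1)[OF dir_deriv_f_C2 x0 y(1)[OF that] y'[OF that] y''[OF that]])
      show "((\<lambda>s. ?g (x0, y s)) has_real_derivative \<xi> \<bullet> q') (at s)"
      proof (rule has_field_derivative_transform_within_open[OF _ I that])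
        show "((\<lambda>s. \<xi> \<bullet> (q + s *\<^sub>R q')) has_real_derivative \<xi> \<bullet> q') (at s)"
          by (auto intro!: derivative_eq_intros simp: inner_add_right)
        show "\<xi> \<bullet> (q + s *\<^sub>R q') = ?g (x0, y s)" if "s \<in> I" for s
          using dir_deriv_x[OF x0 y(1)[OF that]] y(2)[OF that] by simp
      qed
    qed
    have "((\<lambda>s. dir_deriv (0, y1 s) ?g (x0, y s)) has_real_derivative
        dir_deriv (0, y2 t) ?g (x0, y t) + dir_deriv (0, y1 t) (dir_deriv (0, y1 t) ?g) (x0, y t)) (at t)"
      by (rule derivatives_along_y(2)[where y = y, OF dir_deriv_f_C2 x0 y(1)[OF t] y'[OF t] y''[OF t]])
    moreover have "((\<lambda>s. dir_deriv (0, y1 s) ?g (x0, y s)) has_real_derivative 0) (at t)"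
      by (rule has_field_derivative_transform_within_open[OF DERIV_const I t]) (simp add: first)
    ultimately show ?thesis unfolding y0_def v_def w_def by (rule DERIV_unique)
  qed
  have "F2 x1 - F2 x0 = w \<bullet> p' + (H 1 - H 0)"
    unfolding F2_def H_def h_def x_0 x_1 p'_def v_def[symmetric] w_def[symmetric] y0_def[symmetric]
      dir_deriv_y[OF x0 y0] dir_deriv_y[OF x1 y0]
    by (simp add: inner_diff_right)
  with tangent commuted mixed affine show ?thesis by (simp add: \<xi>_def)
qed

text \<open>A function with non-negative second derivative along the segment of products from
\<open>y\<^sub>a\<close> to \<open>y\<^sub>b\<close> seen from \<open>x0\<close> lies below its chord. The point at parameter \<open>\<tau>\<close> serves for all types
\<open>x\<close> simultaneously because the segment depends on \<open>x0\<close> only.\<close>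

lemma intermediate_product_interior:
  assumes x0: "x0 \<in> X" and y\<^sub>a: "y\<^sub>a \<in> Y" and y\<^sub>b: "y\<^sub>b \<in> Y" and \<tau>: "\<tau> \<in> {0..1}"
  shows "\<exists>y\<in>Y. \<forall>x\<in>X. b x y - b x0 y
      \<le> (1 - \<tau>) * (b x y\<^sub>a - b x0 y\<^sub>a) + \<tau> * (b x y\<^sub>b - b x0 y\<^sub>b)"
proof -
  define q where "q = gx x0 y\<^sub>a"
  define q' where "q' = gx x0 y\<^sub>b - gx x0 y\<^sub>a"
  define I where "I = {t. q + t *\<^sub>R q' \<in> gx x0 ` Y}"
  have I: "open I" "convex I"
    unfolding I_def by (rule open_segment_parameters[OF open_gx[OF x0]],
        rule convex_segment_parameters[OF convex_gx[OF in_closure(1)[OF x0]]])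
  have "0 \<in> I" "1 \<in> I" using y\<^sub>a y\<^sub>b by (auto simp: I_def q_def q'_def)
  have "\<tau> \<in> I" using convexD_alt[OF I(2) \<open>0 \<in> I\<close> \<open>1 \<in> I\<close>, of \<tau>] \<tau> by simp
  obtain y y1 y2 where y: "\<And>t. t \<in> I \<Longrightarrow> y t \<in> Y" "\<And>t. t \<in> I \<Longrightarrow> gx x0 (y t) = q + t *\<^sub>R q'"
    and y': "\<And>t. t \<in> I \<Longrightarrow> (y has_vector_derivative y1 t) (at t)"
    and y'': "\<And>t. t \<in> I \<Longrightarrow> (y1 has_vector_derivative y2 t) (at t)"
    by (rule y_segment[OF x0 I(1), of q q'], simp add: I_def, rule that)
  have y_0: "y 0 = y\<^sub>a" and y_1: "y 1 = y\<^sub>b"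
    using inj_onD[OF inj_gx[OF in_closure(1)[OF x0]]] y[OF \<open>0 \<in> I\<close>] y[OF \<open>1 \<in> I\<close>] y\<^sub>a y\<^sub>b in_closure(2)
    by (simp_all add: q_def q'_def)
  have "b x (y \<tau>) - b x0 (y \<tau>) \<le> (1 - \<tau>) * (b x y\<^sub>a - b x0 y\<^sub>a) + \<tau> * (b x y\<^sub>b - b x0 y\<^sub>b)"
    if x: "x \<in> X" for x
  proof -
    note d1 = derivatives_along_y(1)[where y = y, OF f_C2 _ y(1) y' y'']
      and d2 = derivatives_along_y(2)[where y = y, OF f_C2 _ y(1) y' y'']
    have "convex_on I (\<lambda>t. f (x, y t) - f (x0, y t))"
      by (rule f''_ge0_imp_convex[OF I(2) DERIV_diff[OF d1[OF x] d1[OF x0]] DERIV_diff[OF d2[OF x] d2[OF x0]]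
            b_difference_convex_along_y_segment[OF x0 x I(1) y y' y'']])
    from convex_onD[OF this, of \<tau> 0 1] \<tau> \<open>0 \<in> I\<close> \<open>1 \<in> I\<close> show ?thesis
      by (simp add: y_0 y_1)
  qed
  then show ?thesis using y(1)[OF \<open>\<tau> \<in> I\<close>] by blast
qed

text \<open>The inequality is closed under limits and the intermediate products stay in a compact set, so
it passes from interior points to the boundary.\<close>

lemma intermediate_product:
  assumes x0: "x0 \<in> closure X" and y\<^sub>a: "y\<^sub>a \<in> closure Y" and y\<^sub>b: "y\<^sub>b \<in> closure Y" and \<tau>: "\<tau> \<in> {0..1}"
  shows "\<exists>y\<in>closure Y. \<forall>x\<in>closure X. b x y - b x0 y
      \<le> (1 - \<tau>) * (b x y\<^sub>a - b x0 y\<^sub>a) + \<tau> * (b x y\<^sub>b - b x0 y\<^sub>b)"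
proof -
  obtain x0s y0s y1s where x0s: "\<And>n. x0s n \<in> X" "x0s \<longlonglongrightarrow> x0"
    and y0s: "\<And>n. y0s n \<in> Y" "y0s \<longlonglongrightarrow> y\<^sub>a" and y1s: "\<And>n. y1s n \<in> Y" "y1s \<longlonglongrightarrow> y\<^sub>b"
    using x0 y\<^sub>a y\<^sub>b unfolding closure_sequential by metis
  have "\<forall>n. \<exists>y\<in>Y. \<forall>x\<in>X. b x y - b (x0s n) y
      \<le> (1 - \<tau>) * (b x (y0s n) - b (x0s n) (y0s n)) + \<tau> * (b x (y1s n) - b (x0s n) (y1s n))"
    using intermediate_product_interior[OF x0s(1) y0s(1) y1s(1) \<tau>] by blast
  then obtain ys where ys: "\<And>n. ys n \<in> Y" and
    le: "\<And>n x. x \<in> X \<Longrightarrow> b x (ys n) - b (x0s n) (ys n)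
      \<le> (1 - \<tau>) * (b x (y0s n) - b (x0s n) (y0s n)) + \<tau> * (b x (y1s n) - b (x0s n) (y1s n))"
    by metis
  have "\<forall>n. ys n \<in> closure Y" using ys in_closure by blast
  then obtain y r where y: "y \<in> closure Y" and r: "strict_mono r" "(ys \<circ> r) \<longlonglongrightarrow> y"
    using compact_Y unfolding compact_def by blast
  have sub: "(u \<circ> r) \<longlonglongrightarrow> l" if "u \<longlonglongrightarrow> l" for u :: "nat \<Rightarrow> real^'n" and l
    by (rule LIMSEQ_subseq_LIMSEQ[OF that r(1)])
  have "b x y - b x0 y \<le> (1 - \<tau>) * (b x y\<^sub>a - b x0 y\<^sub>a) + \<tau> * (b x y\<^sub>b - b x0 y\<^sub>b)"
    if "x \<in> closure X" for x
  proof -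
    obtain xs where xs: "\<And>n. xs n \<in> X" "xs \<longlonglongrightarrow> x" using \<open>x \<in> closure X\<close> closure_sequential by metis
    show ?thesis
    proof (rule LIMSEQ_le)
      show "(\<lambda>n. b ((xs \<circ> r) n) ((ys \<circ> r) n) - b ((x0s \<circ> r) n) ((ys \<circ> r) n)) \<longlonglongrightarrow> b x y - b x0 y"
        by (intro tendsto_diff tendsto_b sub r xs x0s that x0 y) (use xs ys x0s in_closure in auto)
      show "(\<lambda>n. (1 - \<tau>) * (b ((xs \<circ> r) n) ((y0s \<circ> r) n) - b ((x0s \<circ> r) n) ((y0s \<circ> r) n))
            + \<tau> * (b ((xs \<circ> r) n) ((y1s \<circ> r) n) - b ((x0s \<circ> r) n) ((y1s \<circ> r) n)))
          \<longlonglongrightarrow> (1 - \<tau>) * (b x y\<^sub>a - b x0 y\<^sub>a) + \<tau> * (b x y\<^sub>b - b x0 y\<^sub>b)"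
        by (intro tendsto_add tendsto_mult tendsto_const tendsto_diff tendsto_b sub xs x0s y0s y1s that x0 y\<^sub>a y\<^sub>b)
          (use xs y0s y1s x0s in_closure in auto)
      show "\<exists>N. \<forall>n\<ge>N. b ((xs \<circ> r) n) ((ys \<circ> r) n) - b ((x0s \<circ> r) n) ((ys \<circ> r) n)
          \<le> (1 - \<tau>) * (b ((xs \<circ> r) n) ((y0s \<circ> r) n) - b ((x0s \<circ> r) n) ((y0s \<circ> r) n))
            + \<tau> * (b ((xs \<circ> r) n) ((y1s \<circ> r) n) - b ((x0s \<circ> r) n) ((y1s \<circ> r) n))"
        using le xs by auto
    qed
  qed
  then show ?thesis using y by blast
qed

section \<open>Mixtures of b-convex functions\<close>

text \<open>Both inequalities come from the intermediate product \<open>y\<close>. The first adds the support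
inequalities of \<open>y0\<close> and \<open>y1\<close>. The second uses a type \<open>z\<close> supporting the cost at \<open>y\<close>, for which
\<open>c y - b z y\<close> is at most \<open>c y0 - b z y0\<close> and at most \<open>c y1 - b z y1\<close>.\<close>

lemma support_of_convex_combination:
  assumes x: "x \<in> closure X" and y0: "y0 \<in> closure Y" "y0 \<in> supports b X u0 x"
    and y1: "y1 \<in> closure Y" "y1 \<in> supports b X u1 x" and t: "t \<in> {0..1}"
  shows "\<exists>y\<in>closure Y. y \<in> supports b X (\<lambda>x. (1 - t) * u0 x + t * u1 x) x \<and>
    (\<forall>c. bstar_convex b X Y c \<longrightarrow>
      c y - b x y \<le> (1 - t) * (c y0 - b x y0) + t * (c y1 - b x y1))"
proof -
  obtain y where y: "y \<in> closure Y" and le: "\<And>z. z \<in> closure X \<Longrightarrow> b z y - b x y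
      \<le> (1 - t) * (b z y0 - b x y0) + t * (b z y1 - b x y1)"
    using intermediate_product[OF x y0(1) y1(1) t] by blast
  have "(1 - t) * u0 x + t * u1 x + b z y - b x y \<le> (1 - t) * u0 z + t * u1 z" if z: "z \<in> closure X" for z
  proof -
    have "b z y0 - b x y0 \<le> u0 z - u0 x" "b z y1 - b x y1 \<le> u1 z - u1 x"
      using y0(2) y1(2) z by (auto simp: supports_def)
    then have "(1 - t) * (b z y0 - b x y0) + t * (b z y1 - b x y1)
        \<le> (1 - t) * (u0 z - u0 x) + t * (u1 z - u1 x)"
      using t by (intro add_mono mult_left_mono) auto
    with le[OF z] show ?thesis by (simp add: algebra_simps)
  qed
  then have "y \<in> supports b X (\<lambda>x. (1 - t) * u0 x + t * u1 x) x" by (simp add: supports_def)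
  moreover have "c y - b x y \<le> (1 - t) * (c y0 - b x y0) + t * (c y1 - b x y1)"
    if c: "bstar_convex b X Y c" for c
  proof -
    interpret swap: compact_kernel "\<lambda>y x. b x y" Y X by (rule swapped)
    obtain z where z: "z \<in> closure X" and "z \<in> supports (\<lambda>y x. b x y) Y c y"
      using swap.b_convex_has_support[OF c[unfolded bstar_convex_iff_b_convex] y] by blast
    then have "c y + b z y0 - b z y \<le> c y0" "c y + b z y1 - b z y \<le> c y1"
      using y0(1) y1(1) by (auto simp: supports_def)
    then have "(1 - t) * (c y + b z y0 - b z y - b x y0) + t * (c y + b z y1 - b z y - b x y1)
       \<le> (1 - t) * (c y0 - b x y0) + t * (c y1 - b x y1)"
      using t by (intro add_mono mult_left_mono) auto
    with le[OF z] show ?thesis by (simp add: algebra_simps)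
  qed
  ultimately show ?thesis using y by blast
qed

lemma b_convex_combination:
  assumes "b_convex b X Y u0" "b_convex b X Y u1" "t \<in> {0..1}"
  shows "b_convex b X Y (\<lambda>x. (1 - t) * u0 x + t * u1 x)"
proof (rule b_convex_if_supports)
  fix x assume x: "x \<in> closure X"
  obtain y0 y1 where "y0 \<in> closure Y" "y0 \<in> supports b X u0 x" "y1 \<in> closure Y" "y1 \<in> supports b X u1 x"
    using b_convex_has_support assms(1,2) x by meson
  from support_of_convex_combination[OF x this assms(3)]
  show "\<exists>y\<in>closure Y. y \<in> supports b X (\<lambda>x. (1 - t) * u0 x + t * u1 x) x" by blast
qed

end

section \<open>Differentiability of b-convex functions\<close>

lemma compact_tendsto_if_unique_limit:
  fixes y :: "nat \<Rightarrow> 'a::metric_space"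
  assumes "compact T" "\<And>n. y n \<in> T"
    and unique: "\<And>r l. strict_mono r \<Longrightarrow> l \<in> T \<Longrightarrow> (y \<circ> r) \<longlonglongrightarrow> l \<Longrightarrow> l = L"
  shows "y \<longlonglongrightarrow> L"
proof (rule ccontr)
  assume "\<not> y \<longlonglongrightarrow> L"
  then obtain e where "e > 0" and "\<not> (\<forall>\<^sub>F n in sequentially. dist (y n) L < e)"
    unfolding tendsto_iff by blast
  then have "\<exists>\<^sub>F n in sequentially. dist (y n) L \<ge> e" by (simp add: frequently_def not_le)
  then have "infinite {n. dist (y n) L \<ge> e}" by (simp add: frequently_cofinite flip: cofinite_eq_sequentially)
  then obtain r :: "nat \<Rightarrow> nat" where r: "strict_mono r" "\<And>n. dist (y (r n)) L \<ge> e"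
    using infinite_enumerate by (metis mem_Collect_eq)
  have "\<forall>n. (y \<circ> r) n \<in> T" using assms(2) by simp
  then obtain l s where l: "l \<in> T" and s: "strict_mono (s :: nat \<Rightarrow> nat)" "((y \<circ> r) \<circ> s) \<longlonglongrightarrow> l"
    using assms(1) unfolding compact_def by blast
  have "l = L" using unique[of "r \<circ> s" l] strict_mono_o[OF r(1) s(1)] l s(2) by (simp add: o_assoc)
  then have "(\<lambda>n. dist (y (r (s n))) L) \<longlonglongrightarrow> 0"
    using iffD1[OF tendsto_dist_iff s(2)] by (simp add: o_def)
  then have "\<exists>n. dist (y (r (s n))) L < e"
    using order_tendstoD(2)[OF _ \<open>e > 0\<close>] eventually_happens sequentially_bot by blast
  then show False using r(2) by (simp add: not_less[symmetric])
qed

context smooth_kernel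
begin

lemma continuous_gx_right: assumes "x \<in> closure X" shows "continuous_on (closure Y) (gx x)"
proof -
  have "continuous_on (closure Y) (\<lambda>y. case (x, y) of (x, y) \<Rightarrow> gx x y)"
    by (rule continuous_on_compose2[OF continuous_gx]) (use assms in \<open>auto intro!: continuous_intros\<close>)
  then show ?thesis by simp
qed

text \<open>The expansion is strict, with both endpoints free near \<open>x0\<close>, and uniform up to the
boundary in \<open>y\<close>. This lets it be used with supports at neighbouring points, which are
different products.\<close>

lemma uniform_first_order_expansion:
  assumes x0: "x0 \<in> X" and e: "e > 0"
  obtains d where "d > 0" "ball x0 d \<subseteq> X"
    "\<And>x z y. x \<in> ball x0 d \<Longrightarrow> z \<in> ball x0 d \<Longrightarrow> y \<in> closure Y \<Longrightarrow>
      \<bar>b z y - b x y - (z - x) \<bullet> gx x0 y\<bar> \<le> e * norm (z - x)"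
proof -
  have "uniformly_continuous_on (closure X \<times> closure Y) (\<lambda>(x, y). gx x y)"
    using compact_uniformly_continuous[OF continuous_gx compact_Times[OF compact_X compact_Y]] .
  then obtain d1 where "d1 > 0" and d1: "\<And>p q. p \<in> closure X \<times> closure Y \<Longrightarrow> q \<in> closure X \<times> closure Y \<Longrightarrow>
      dist q p < d1 \<Longrightarrow> dist (case q of (x, y) \<Rightarrow> gx x y) (case p of (x, y) \<Rightarrow> gx x y) < e"
    using e unfolding uniformly_continuous_on_def by metis
  obtain d2 where d2: "d2 > 0" "ball x0 d2 \<subseteq> X" using open_X x0 open_contains_ball by blast
  define d where "d = min d1 d2"
  have sub: "ball x0 d \<subseteq> X" using d2 by (auto simp: d_def)
  have interior: "\<bar>b z y - b x y - (z - x) \<bullet> gx x0 y\<bar> \<le> e * norm (z - x)"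
    if x: "x \<in> ball x0 d" and z: "z \<in> ball x0 d" and y: "y \<in> Y" for x z y
  proof -
    define \<gamma> where "\<gamma> s = x + s *\<^sub>R (z - x)" for s
    have \<gamma>: "\<gamma> s \<in> ball x0 d" if "0 \<le> s" "s \<le> 1" for s
      using convexD_alt[OF convex_ball x z that] by (simp add: \<gamma>_def algebra_simps)
    have "((\<lambda>s. b (\<gamma> s) y) has_real_derivative (z - x) \<bullet> gx (\<gamma> s) y) (at s)" if "0 \<le> s" "s \<le> 1" for s
    proof -
      have "\<gamma> s \<in> X" using \<gamma>[OF that] sub by blast
      have "(\<gamma> has_vector_derivative (z - x)) (at s)"
        unfolding \<gamma>_def by (auto simp: has_vector_derivative_def intro!: derivative_eq_intros)
      from derivatives_along_x(1)[OF f_C2 \<open>\<gamma> s \<in> X\<close> y this has_vector_derivative_const]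
      show ?thesis using dir_deriv_x[OF \<open>\<gamma> s \<in> X\<close> y] by simp
    qed
    from MVT2[OF zero_less_one this]
    obtain s where s: "0 < s" "s < 1" and eq: "b (\<gamma> 1) y - b (\<gamma> 0) y = (1 - 0) * ((z - x) \<bullet> gx (\<gamma> s) y)"
      by blast
    then have "b z y - b x y - (z - x) \<bullet> gx x0 y = (z - x) \<bullet> (gx (\<gamma> s) y - gx x0 y)"
      by (simp add: \<gamma>_def inner_diff_right)
    also have "\<bar>\<dots>\<bar> \<le> norm (z - x) * norm (gx (\<gamma> s) y - gx x0 y)" by (rule Cauchy_Schwarz_ineq2)
    also have "\<dots> \<le> norm (z - x) * e"
    proof (intro mult_left_mono norm_ge_zero)
      have "\<gamma> s \<in> ball x0 d" using \<gamma> s by simp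
      then have "\<gamma> s \<in> closure X" "dist (\<gamma> s) x0 < d1"
        using sub in_closure by (auto simp: d_def dist_commute)
      then show "norm (gx (\<gamma> s) y - gx x0 y) \<le> e"
        using d1[of "(x0, y)" "(\<gamma> s, y)"] x0 y in_closure
        by (simp add: dist_Pair_Pair dist_norm)
    qed
    finally show ?thesis by (simp add: mult.commute)
  qed
  show ?thesis
  proof (rule that)
    show "d > 0" using \<open>d1 > 0\<close> d2 by (simp add: d_def)
    fix x z y assume x: "x \<in> ball x0 d" and z: "z \<in> ball x0 d" and y: "y \<in> closure Y"
    have cb: "continuous_on (closure Y) (\<lambda>y. b x y)" if "x \<in> X" for x
    proof -
      have "continuous_on (closure Y) (\<lambda>y. case (x, y) of (x, y) \<Rightarrow> b x y)"
        by (rule continuous_on_compose2[OF continuous_b])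
          (use that in_closure in \<open>auto intro!: continuous_intros\<close>)
      then show ?thesis by simp
    qed
    show "\<bar>b z y - b x y - (z - x) \<bullet> gx x0 y\<bar> \<le> e * norm (z - x)"
      by (rule continuous_le_on_closure[OF _ y interior[OF x z]])
        (use x z sub in \<open>intro continuous_intros cb continuous_gx_right in_closure x0; blast\<close>)
  qed (rule sub)
qed

lemma b_has_derivative_gx:
  assumes x: "x \<in> X" and y: "y \<in> closure Y"
  shows "((\<lambda>z. b z y) has_derivative (\<lambda>w. w \<bullet> gx x y)) (at x)"
  unfolding has_derivative_at_alt
proof (intro conjI allI impI)
  fix e :: real assume "e > 0"
  obtain d where "d > 0" "ball x d \<subseteq> X" and d: "\<And>x' z y. x' \<in> ball x d \<Longrightarrow> z \<in> ball x d \<Longrightarrow> y \<in> closure Y \<Longrightarrow>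
      \<bar>b z y - b x' y - (z - x') \<bullet> gx x y\<bar> \<le> e * norm (z - x')"
    using uniform_first_order_expansion[OF x \<open>e > 0\<close>] by metis
  show "\<exists>d>0. \<forall>z. norm (z - x) < d \<longrightarrow> norm (b z y - b x y - (z - x) \<bullet> gx x y) \<le> e * norm (z - x)"
    using d[of x _ y] \<open>d > 0\<close> y by (intro exI[of _ d]) (auto simp: dist_norm norm_minus_commute)
qed (rule bounded_linear_inner_left)

text \<open>At \<open>x\<close> the difference of \<open>u\<close> and \<open>b\<close> with product \<open>y\<close> is minimal, so its gradient vanishes.\<close>

lemma gradient_at_support:
  assumes x: "x \<in> X" and y: "y \<in> closure Y" "y \<in> supports b X u x" and u: "GDERIV u x :> p"
  shows "p = gx x y"
proof -
  have "((\<lambda>z. u z - b z y) has_derivative (\<lambda>w. w \<bullet> p - w \<bullet> gx x y)) (at x)"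
    by (rule has_derivative_diff[OF u[unfolded gderiv_def] b_has_derivative_gx[OF x y(1)]])
  moreover have "\<forall>z\<in>X. u x - b x y \<le> u z - b z y"
    using y(2) in_closure by (force simp: supports_def)
  ultimately have "(\<lambda>w. w \<bullet> p - w \<bullet> gx x y) = (\<lambda>w. 0)"
    using differential_zero_maxmin[OF x open_X] by blast
  then have "w \<bullet> p = w \<bullet> gx x y" for w by (metis eq_iff_diff_eq_0)
  then show ?thesis by (metis vector_eq_ldot)
qed

text \<open>Danskin's argument: a support at \<open>x\<close> bounds the increment of \<open>u\<close> from below, a
support at \<open>z\<close> bounds it from above, and as \<open>z\<close> tends to \<open>x\<close> the supports at \<open>z\<close> can only accumulate
at the unique support at \<open>x\<close>.\<close>

lemma has_derivative_if_unique_support: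
  assumes u: "b_convex b X Y u" and x: "x \<in> X"
    and unique: "\<And>y'. y' \<in> closure Y \<Longrightarrow> y' \<in> supports b X u x \<Longrightarrow> y' = y"
  shows "(u has_derivative (\<lambda>w. w \<bullet> gx x y)) (at x)"
  unfolding has_derivative_at_alt
proof (intro conjI allI impI)
  have y: "y \<in> closure Y" "y \<in> supports b X u x"
    using b_convex_has_support[OF u in_closure(1)[OF x]] unique by blast+
  fix e :: real assume "e > 0"
  then have "e / 2 > 0" by simp
  obtain d1 where "d1 > 0" "ball x d1 \<subseteq> X" and d1: "\<And>x' z y. x' \<in> ball x d1 \<Longrightarrow> z \<in> ball x d1 \<Longrightarrow> y \<in> closure Y \<Longrightarrow>
      \<bar>b z y - b x' y - (z - x') \<bullet> gx x y\<bar> \<le> e / 2 * norm (z - x')"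
    using uniform_first_order_expansion[OF x \<open>e / 2 > 0\<close>] by metis
  have "\<exists>d2>0. \<forall>z\<in>X. dist z x < d2 \<longrightarrow> (\<forall>y'\<in>closure Y. y' \<in> supports b X u z \<longrightarrow>
      dist (gx x y') (gx x y) < e / 2)"
  proof (rule ccontr)
    assume "\<not> ?thesis"
    then have "\<forall>n. \<exists>z y'. z \<in> X \<and> dist z x < inverse (Suc n) \<and> y' \<in> closure Y \<and> y' \<in> supports b X u z \<and>
      \<not> dist (gx x y') (gx x y) < e / 2"
      by (metis inverse_positive_iff_positive of_nat_0_less_iff zero_less_Suc)
    then obtain zs ys where zs: "\<And>n. zs n \<in> X" "\<And>n. dist (zs n) x < inverse (Suc n)"
      and ys: "\<And>n. ys n \<in> closure Y" "\<And>n. ys n \<in> supports b X u (zs n)"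
      and far: "\<And>n. \<not> dist (gx x (ys n)) (gx x y) < e / 2" by metis
    have "zs \<longlonglongrightarrow> x"
      by (rule metric_tendsto_imp_tendsto[OF LIMSEQ_inverse_real_of_nat])
        (use zs(2) in \<open>auto intro!: always_eventually less_imp_le simp: dist_real_def\<close>)
    have "ys \<longlonglongrightarrow> y"
    proof (rule compact_tendsto_if_unique_limit[OF compact_Y ys(1)])
      fix r l assume r: "strict_mono r" and l: "l \<in> closure Y" "(ys \<circ> r) \<longlonglongrightarrow> l"
      have "l \<in> supports b X u x"
        by (rule supports_limit[OF u LIMSEQ_subseq_LIMSEQ[OF \<open>zs \<longlonglongrightarrow> x\<close> r] l(2)])
          (use x l zs ys in_closure in auto)
      then show "l = y" using unique l by blast
    qed
    then have "(\<lambda>n. gx x (ys n)) \<longlonglongrightarrow> gx x y"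
      by (rule continuous_on_tendsto_compose[OF continuous_gx_right[OF in_closure(1)[OF x]] _ y(1)])
        (simp add: ys(1))
    then have "\<forall>\<^sub>F n in sequentially. dist (gx x (ys n)) (gx x y) < e / 2"
      using \<open>e / 2 > 0\<close> by (rule tendstoD)
    then show False using far by simp
  qed
  then obtain d2 where "d2 > 0" and d2: "\<And>z y'. z \<in> X \<Longrightarrow> dist z x < d2 \<Longrightarrow> y' \<in> closure Y \<Longrightarrow>
      y' \<in> supports b X u z \<Longrightarrow> dist (gx x y') (gx x y) < e / 2" by blast
  show "\<exists>d>0. \<forall>z. norm (z - x) < d \<longrightarrow> norm (u z - u x - (z - x) \<bullet> gx x y) \<le> e * norm (z - x)"
  proof (intro exI[of _ "min d1 d2"] conjI allI impI)
    show "0 < min d1 d2" using \<open>d1 > 0\<close> \<open>d2 > 0\<close> by simp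
    fix z assume "norm (z - x) < min d1 d2"
    then have z: "z \<in> ball x d1" "dist z x < d2" "z \<in> X"
      using \<open>ball x d1 \<subseteq> X\<close> by (auto simp: dist_norm norm_minus_commute)
    have "x \<in> ball x d1" using \<open>d1 > 0\<close> by simp
    note first_order = d1[OF this z(1)]
    obtain y' where y': "y' \<in> closure Y" "y' \<in> supports b X u z"
      using b_convex_has_support[OF u in_closure(1)[OF z(3)]] by blast
    have "u x + b z y - b x y \<le> u z" using y(2) in_closure z(3) by (simp add: supports_def)
    then have lower: "- (e / 2 * norm (z - x)) \<le> u z - u x - (z - x) \<bullet> gx x y"
      using first_order[OF y(1)] unfolding abs_le_iff by linarith
    have "u z + b x y' - b z y' \<le> u x" using y'(2) in_closure x by (simp add: supports_def)
    then have "u z - u x - (z - x) \<bullet> gx x y \<le> e / 2 * norm (z - x) + (z - x) \<bullet> (gx x y' - gx x y)"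
      using first_order[OF y'(1)] unfolding abs_le_iff inner_diff_right by linarith
    also have "(z - x) \<bullet> (gx x y' - gx x y) \<le> norm (z - x) * norm (gx x y' - gx x y)"
      by (rule norm_cauchy_schwarz)
    also have "\<dots> \<le> norm (z - x) * (e / 2)"
      using d2[OF z(3,2) y'] by (intro mult_left_mono) (auto simp: dist_norm)
    finally have "u z - u x - (z - x) \<bullet> gx x y \<le> e * norm (z - x)" by (simp add: field_simps)
    moreover have "e / 2 * norm (z - x) \<le> e * norm (z - x)"
      using \<open>e > 0\<close> by (intro mult_right_mono) auto
    ultimately show "norm (u z - u x - (z - x) \<bullet> gx x y) \<le> e * norm (z - x)"
      using lower unfolding real_norm_def abs_le_iff by linarith
  qed
qed (rule bounded_linear_inner_left)

end

section \<open>Lipschitz hypersurfaces carrying the kinks\<close>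

text \<open>The extension is the lower envelope of the cones with slope \<open>L\<close> standing on the graph of \<open>g\<close>.\<close>

lemma McShane_extension:
  fixes g :: "'a::metric_space \<Rightarrow> real"
  assumes g: "L-lipschitz_on A g" and "A \<noteq> {}"
  obtains f where "L-lipschitz_on UNIV f" "\<And>a. a \<in> A \<Longrightarrow> f a = g a"
proof -
  have L: "0 \<le> L" by (rule lipschitz_on_nonneg[OF g])
  have g_le: "g a \<le> g a' + L * dist a' a" if "a \<in> A" "a' \<in> A" for a a'
    using lipschitz_onD[OF g that] by (simp add: dist_real_def dist_commute)
  define f where "f z = (INF a\<in>A. g a + L * dist z a)" for z
  obtain a0 where a0: "a0 \<in> A" using \<open>A \<noteq> {}\<close> by blast
  have tri: "L * dist a0 a \<le> L * dist z a0 + L * dist z a" for z a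
    using mult_left_mono[OF dist_triangle3[of a0 a z] L] by (simp add: algebra_simps)
  have bdd: "bdd_below ((\<lambda>a. g a + L * dist z a) ` A)" for z
  proof (rule bdd_belowI2)
    show "g a0 - L * dist z a0 \<le> g a + L * dist z a" if "a \<in> A" for a
      using g_le[OF a0 that] tri[of a z] by (simp add: dist_commute)
  qed
  have f_le: "f z \<le> g a + L * dist z a" if "a \<in> A" for z a
    unfolding f_def by (rule cINF_lower[OF bdd that])
  have "f z \<le> f z' + L * dist z z'" for z z'
  proof -
    have "f z - L * dist z z' \<le> g a + L * dist z' a" if "a \<in> A" for a
      using f_le[OF that, of z] mult_left_mono[OF dist_triangle[of z a z'] L] by (simp add: algebra_simps)
    then have "f z - L * dist z z' \<le> f z'"
      unfolding f_def[of z'] using \<open>A \<noteq> {}\<close> by (intro cINF_greatest) auto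
    then show ?thesis by simp
  qed
  note f_lip = this
  have "L-lipschitz_on UNIV f"
  proof (rule lipschitz_onI[OF _ L])
    show "dist (f z) (f z') \<le> L * dist z z'" for z z'
      using f_lip[of z z'] f_lip[of z' z] by (simp add: dist_real_def dist_commute abs_le_iff)
  qed
  moreover have "f a = g a" if "a \<in> A" for a
  proof (rule antisym)
    show "f a \<le> g a" using f_le[OF that, of a] by simp
    show "g a \<le> f a"
      unfolding f_def using \<open>A \<noteq> {}\<close> g_le[OF that] by (intro cINF_greatest) (auto simp: dist_commute)
  qed
  ultimately show ?thesis by (rule that)
qed

text \<open>Chords of \<open>E\<close> make an angle of at least 60 degrees with \<open>\<nu>\<close>, so the
projection along \<open>\<nu>\<close> is injective on \<open>E\<close>, and the height over the projection is a
Lipschitz function, which extends to the whole hyperplane.\<close>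

lemma cone_condition_imp_subset_lipschitz_hypersurface:
  fixes E :: "'a::euclidean_space set"
  assumes \<nu>: "norm \<nu> = 1"
    and cone: "\<And>x z. x \<in> E \<Longrightarrow> z \<in> E \<Longrightarrow> (z - x) \<bullet> \<nu> \<le> norm (z - x) / 2"
  shows "\<exists>S. lipschitz_hypersurface S \<and> E \<subseteq> S"
proof (cases "E = {}")
  case True
  then show ?thesis by (intro exI[of _ "{}"]) (simp add: lipschitz_hypersurface_def)
next
  case False
  \<comment> \<open>Orthogonal projection to the hyperplane with normal \<open>\<nu>\<close>.\<close>
  define P where "P x = x - (x \<bullet> \<nu>) *\<^sub>R \<nu>" for x
  have nn: "\<nu> \<bullet> \<nu> = 1" using \<nu> by (simp add: norm_eq_1)
  have P_diff: "P z - P x = P (z - x)" for x z by (simp add: P_def inner_diff_left algebra_simps)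
  have P_orth: "P x \<bullet> \<nu> = 0" for x by (simp add: P_def inner_diff_left nn)
  have height: "\<bar>(z - x) \<bullet> \<nu>\<bar> \<le> norm (P z - P x)" if "x \<in> E" "z \<in> E" for x z
  proof -
    define w where "w = z - x"
    have "(x - z) \<bullet> \<nu> = - (w \<bullet> \<nu>)" "norm (x - z) = norm w"
      by (simp_all add: w_def inner_diff_left norm_minus_commute)
    then have "\<bar>w \<bullet> \<nu>\<bar> \<le> norm w / 2"
      using cone[OF that] cone[OF that(2,1)] unfolding w_def[symmetric] by linarith
    then have "(w \<bullet> \<nu>)\<^sup>2 \<le> (norm w / 2)\<^sup>2" using abs_le_square_iff[of "w \<bullet> \<nu>" "norm w / 2"] by simp
    then have "4 * (w \<bullet> \<nu>)\<^sup>2 \<le> (norm w)\<^sup>2" by (simp add: power_divide)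
    moreover have "(norm w)\<^sup>2 = (norm (P w))\<^sup>2 + (w \<bullet> \<nu>)\<^sup>2"
      unfolding power2_norm_eq_inner P_def
      by (simp add: inner_diff_left inner_diff_right nn power2_eq_square inner_commute)
    moreover have "(w \<bullet> \<nu>)\<^sup>2 \<ge> 0" by simp
    ultimately have "(w \<bullet> \<nu>)\<^sup>2 \<le> (norm (P w))\<^sup>2" by linarith
    then have "\<bar>w \<bullet> \<nu>\<bar> \<le> norm (P w)" using abs_le_square_iff[of "w \<bullet> \<nu>" "norm (P w)"] by simp
    then show ?thesis unfolding P_diff w_def .
  qed
  have P_inj: "x = z" if "x \<in> E" "z \<in> E" "P x = P z" for x z
  proof -
    have "(z - x) \<bullet> \<nu> = 0" using height[OF that(1,2)] that(3) by simp
    then have "z - x = P z - P x" unfolding P_diff by (simp add: P_def)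
    then show ?thesis using that(3) by simp
  qed
  define g where "g a = inv_into E P a \<bullet> \<nu>" for a
  have gP: "g (P x) = x \<bullet> \<nu>" if "x \<in> E" for x
    unfolding g_def using P_inj that by (subst inv_into_f_f) (auto intro: inj_onI)
  have "1-lipschitz_on (P ` E) g"
    by (rule lipschitz_onI)
      (use height gP in \<open>auto simp: dist_norm inner_diff_left\<close>)
  then obtain h where h: "1-lipschitz_on UNIV h" "\<And>a. a \<in> P ` E \<Longrightarrow> h a = g a"
    using McShane_extension False by blast
  define S where "S = {z + h z *\<^sub>R \<nu> | z. z \<bullet> \<nu> = 0}"
  have "lipschitz_hypersurface S"
    unfolding lipschitz_hypersurface_def
  proof (intro ballI exI conjI)
    show "1-lipschitz_on {z. z \<bullet> \<nu> = 0} h" using lipschitz_on_subset[OF h(1)] by simp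
    show "S \<inter> UNIV = {z + h z *\<^sub>R \<nu> |z. z \<bullet> \<nu> = 0} \<inter> UNIV" unfolding S_def ..
  qed (use \<nu> in auto)
  moreover have "E \<subseteq> S"
  proof
    fix x assume "x \<in> E"
    then have "x = P x + h (P x) *\<^sub>R \<nu>" using h(2) gP by (simp add: P_def)
    then show "x \<in> S" unfolding S_def using P_orth by blast
  qed
  ultimately show ?thesis by blast
qed

context cross_curved_kernel
begin

text \<open>Let \<open>p \<noteq> p'\<close> be the gradients of \<open>y\<close> and \<open>y'\<close>. For types \<open>x\<close>, \<open>z\<close> near \<open>x0\<close>, a
support near \<open>y\<close> at \<open>x\<close> gives nearly \<open>u z - u x \<ge> (z - x) \<bullet> p\<close>, and a support near \<open>y'\<close> at \<open>z\<close> gives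
nearly \<open>u x - u z \<ge> (x - z) \<bullet> p'\<close>. The sum bounds \<open>(z - x) \<bullet> (p - p')\<close> by a small multiple of the
distance: the set of such types satisfies the cone condition in the direction \<open>p - p'\<close>.\<close>

lemma local_multiple_supports_cone:
  assumes x0: "x0 \<in> X" and y: "y \<in> closure Y" and y': "y' \<in> closure Y" and "y \<noteq> y'"
  shows "\<exists>W. open W \<and> (x0, y, y') \<in> W \<and>
    (\<exists>S. lipschitz_hypersurface S \<and>
      {x\<in>X. \<exists>z\<in>closure Y. \<exists>z'\<in>closure Y. z \<in> supports b X u x \<and> z' \<in> supports b X u x \<and> (x, z, z') \<in> W} \<subseteq> S)"
proof -
  define p where "p = gx x0 y"
  define p' where "p' = gx x0 y'"
  have cl: "x0 \<in> closure X" using in_closure x0 by blast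
  have "p \<noteq> p'" using inj_onD[OF inj_gx[OF cl] _ y y'] \<open>y \<noteq> y'\<close> unfolding p_def p'_def by blast
  then have D: "norm (p - p') > 0" by simp
  \<comment> \<open>Two expansions with an error of twice \<open>e\<close> each yield the constant one half of the cone condition.\<close>
  define e where "e = norm (p - p') / 8"
  have "e > 0" using D by (simp add: e_def)
  obtain d where "d > 0" "ball x0 d \<subseteq> X" and d: "\<And>x z y. x \<in> ball x0 d \<Longrightarrow> z \<in> ball x0 d \<Longrightarrow> y \<in> closure Y \<Longrightarrow>
      \<bar>b z y - b x y - (z - x) \<bullet> gx x0 y\<bar> \<le> e * norm (z - x)"
    using uniform_first_order_expansion[OF x0 \<open>e > 0\<close>] by metis
  have near: "\<exists>r>0. \<forall>z\<in>closure Y. dist z y < r \<longrightarrow> dist (gx x0 z) (gx x0 y) < e" if "y \<in> closure Y" for y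
    using continuous_gx_right[OF cl] that \<open>e > 0\<close> unfolding continuous_on_iff by blast
  obtain r where "r > 0" and r: "\<And>z. z \<in> closure Y \<Longrightarrow> dist z y < r \<Longrightarrow> dist (gx x0 z) p < e"
    using near[OF y] unfolding p_def by blast
  obtain r' where "r' > 0" and r': "\<And>z. z \<in> closure Y \<Longrightarrow> dist z y' < r' \<Longrightarrow> dist (gx x0 z) p' < e"
    using near[OF y'] unfolding p'_def by blast
  define W where "W = ball x0 d \<times> (ball y r \<times> ball y' r')"
  define E where "E = {x\<in>X. \<exists>z\<in>closure Y. \<exists>z'\<in>closure Y. z \<in> supports b X u x \<and> z' \<in> supports b X u x \<and> (x, z, z') \<in> W}"
  define \<nu> where "\<nu> = (p - p') /\<^sub>R norm (p - p')"
  have "norm \<nu> = 1" unfolding \<nu>_def using D by simp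
  have expand: "b z w - b x w \<ge> (z - x) \<bullet> q - 2 * e * norm (z - x)"
    if "x \<in> ball x0 d" "z \<in> ball x0 d" "w \<in> closure Y" "dist (gx x0 w) q < e" for x z w q
  proof -
    have "\<bar>(z - x) \<bullet> (gx x0 w - q)\<bar> \<le> norm (z - x) * norm (gx x0 w - q)" by (rule Cauchy_Schwarz_ineq2)
    also have "\<dots> \<le> norm (z - x) * e" using that(4) by (intro mult_left_mono) (auto simp: dist_norm)
    finally have "(z - x) \<bullet> (gx x0 w - q) \<ge> - (e * norm (z - x))" by (simp add: abs_le_iff mult.commute)
    then show ?thesis using d[OF that(1-3)] unfolding inner_diff_right abs_le_iff by linarith
  qed
  have "(z - x) \<bullet> \<nu> \<le> norm (z - x) / 2" if x: "x \<in> E" and z: "z \<in> E" for x z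
  proof -
    obtain w where w: "w \<in> closure Y" "w \<in> supports b X u x" "x \<in> ball x0 d" "dist w y < r" "x \<in> X"
      using x unfolding E_def W_def by (auto simp: dist_commute)
    obtain w' where w': "w' \<in> closure Y" "w' \<in> supports b X u z" "z \<in> ball x0 d" "dist w' y' < r'" "z \<in> X"
      using z unfolding E_def W_def by (auto simp: dist_commute)
    have "u x + b z w - b x w \<le> u z" "u z + b x w' - b z w' \<le> u x"
      using w(2,5) w'(2,5) in_closure by (auto simp: supports_def)
    moreover have "b z w - b x w \<ge> (z - x) \<bullet> p - 2 * e * norm (z - x)"
      by (rule expand[OF w(3) w'(3) w(1) r[OF w(1,4)]])
    moreover have "b x w' - b z w' \<ge> - ((z - x) \<bullet> p') - 2 * e * norm (z - x)"
      using expand[OF w'(3) w(3) w'(1) r'[OF w'(1,4)]]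
      by (simp add: inner_diff_left norm_minus_commute)
    ultimately have "(z - x) \<bullet> p - (z - x) \<bullet> p' \<le> 4 * e * norm (z - x)" by linarith
    then have "(z - x) \<bullet> (p - p') \<le> norm (p - p') * (norm (z - x) / 2)"
      by (simp add: inner_diff_right e_def)
    then have "(z - x) \<bullet> (p - p') / norm (p - p') \<le> norm (z - x) / 2"
      using D by (simp add: pos_divide_le_eq mult.commute)
    then show ?thesis by (simp only: \<nu>_def inner_scaleR_right divide_inverse_commute)
  qed
  from cone_condition_imp_subset_lipschitz_hypersurface[OF \<open>norm \<nu> = 1\<close> this]
  obtain S where "lipschitz_hypersurface S" "E \<subseteq> S" by blast
  moreover have "open W" "(x0, y, y') \<in> W"
    using \<open>d > 0\<close> \<open>r > 0\<close> \<open>r' > 0\<close> by (auto simp: W_def intro!: open_Times)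
  ultimately show ?thesis unfolding E_def by blast
qed

text \<open>Each triple of a type and two distinct products has a neighbourhood as in the previous
lemma; by the Lindelof property countably many of them suffice.\<close>

lemma multiple_supports_covered:
  obtains \<S> where "countable \<S>" "\<And>S. S \<in> \<S> \<Longrightarrow> lipschitz_hypersurface S"
    "{x\<in>X. \<exists>y\<in>closure Y. \<exists>y'\<in>closure Y. y \<noteq> y' \<and> y \<in> supports b X u x \<and> y' \<in> supports b X u x} \<subseteq> \<Union>\<S>"
proof -
  define E where "E W = {x\<in>X. \<exists>z\<in>closure Y. \<exists>z'\<in>closure Y. z \<in> supports b X u x \<and> z' \<in> supports b X u x \<and> (x, z, z') \<in> W}" for W
  define \<W> where "\<W> = {W. open W \<and> (\<exists>S. lipschitz_hypersurface S \<and> E W \<subseteq> S)}"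
  have open_W: "\<And>W. W \<in> \<W> \<Longrightarrow> open W" by (simp add: \<W>_def)
  obtain \<V> where \<V>: "\<V> \<subseteq> \<W>" "countable \<V>" "\<Union>\<V> = \<Union>\<W>"
    using Lindelof[of \<W>] open_W by metis
  have "\<forall>W\<in>\<V>. \<exists>S. lipschitz_hypersurface S \<and> E W \<subseteq> S" using \<V>(1) by (auto simp: \<W>_def)
  then obtain F where F: "\<And>W. W \<in> \<V> \<Longrightarrow> lipschitz_hypersurface (F W)" "\<And>W. W \<in> \<V> \<Longrightarrow> E W \<subseteq> F W"
    by metis
  show ?thesis
  proof (rule that)
    show "countable (F ` \<V>)" using \<V>(2) by simp
    show "lipschitz_hypersurface S" if "S \<in> F ` \<V>" for S using F(1) that by blast
    show "{x\<in>X. \<exists>y\<in>closure Y. \<exists>y'\<in>closure Y. y \<noteq> y' \<and> y \<in> supports b X u x \<and> y' \<in> supports b X u x} \<subseteq> \<Union>(F ` \<V>)"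
    proof
      fix x assume "x \<in> {x\<in>X. \<exists>y\<in>closure Y. \<exists>y'\<in>closure Y. y \<noteq> y' \<and> y \<in> supports b X u x \<and> y' \<in> supports b X u x}"
      then obtain y y' where x: "x \<in> X" and y: "y \<in> closure Y" "y' \<in> closure Y" "y \<noteq> y'"
        "y \<in> supports b X u x" "y' \<in> supports b X u x" by blast
      from local_multiple_supports_cone[OF x y(1,2,3), of u] have "(x, y, y') \<in> \<Union>\<W>"
        unfolding \<W>_def E_def by blast
      then obtain W where "W \<in> \<V>" "(x, y, y') \<in> W" using \<V>(3) by blast
      then show "x \<in> \<Union>(F ` \<V>)" using F(2) x y unfolding E_def by blast
    qed
  qed
qed

end

section \<open>Measurable responses and integrable losses\<close>

text \<open>In a complete measure space, changing a function on a null set preserves measurability.\<close>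

lemma (in complete_measure) borel_measurable_AE_cong:
  fixes f g :: "'a \<Rightarrow> 'b::topological_space"
  assumes f: "f \<in> borel_measurable M" and eq: "AE x in M. f x = g x"
  shows "g \<in> borel_measurable M"
proof (rule measurableI)
  fix A :: "'b set" assume "A \<in> sets borel"
  then have "f -` A \<inter> space M \<in> sets M" using measurable_sets[OF f] by blast
  moreover have "AE x in M. x \<in> f -` A \<inter> space M \<longleftrightarrow> x \<in> g -` A \<inter> space M"
    using eq by (rule AE_mp) simp
  ultimately show "g -` A \<inter> space M \<in> sets M" using in_sets_AE by blast
qed simp

context cross_curved_kernel
begin

lemma tendsto_gx:
  assumes "xs \<longlonglongrightarrow> x" "ys \<longlonglongrightarrow> y" "x \<in> closure X" "y \<in> closure Y"
    "\<And>n. xs n \<in> closure X" "\<And>n. ys n \<in> closure Y"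
  shows "(\<lambda>n. gx (xs n) (ys n)) \<longlonglongrightarrow> gx x y"
  using continuous_on_tendsto_compose[OF continuous_gx tendsto_Pair[OF assms(1,2)]] assms(3-6) by simp

lemma yb_gx: "x \<in> closure X \<Longrightarrow> y \<in> closure Y \<Longrightarrow> yb b X Y x (gx x y) = y"
  unfolding yb_def by (rule the_inv_into_f_f[OF inj_gx])

text \<open>Pairs of a type in \<open>X\<close> and an admissible gradient form a relatively closed set on which
the inverse gradient map is continuous, by compactness of the set of products. Off this set the
definite description defining the inverse has no witness and takes one and the same value.\<close>

lemma yb_borel_measurable:
  obtains H where "H \<in> borel_measurable borel" "\<And>x q. x \<in> X \<Longrightarrow> H (x, q) = yb b X Y x q"
proof -
  define R where "R = {(x, q). x \<in> X \<and> q \<in> gx x ` closure Y}"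
  have R_E: "\<exists>y\<in>closure Y. gx (fst z) y = snd z" if "z \<in> R" for z
    using that unfolding R_def by (force simp: case_prod_unfold)
  have R_X: "fst z \<in> closure X" if "z \<in> R" for z
    using that in_closure unfolding R_def by auto
  have "R = (X \<times> UNIV) \<inter> closure R"
  proof (intro subset_antisym subsetI)
    fix z assume "z \<in> R" then show "z \<in> (X \<times> UNIV) \<inter> closure R"
      using closure_subset unfolding R_def by fastforce
  next
    fix z assume z: "z \<in> (X \<times> UNIV) \<inter> closure R"
    then have "z \<in> closure R" by blast
    then obtain zs where zs: "\<And>n. zs n \<in> R" "zs \<longlonglongrightarrow> z" using closure_sequential by metis
    have "\<forall>n. \<exists>y. y \<in> closure Y \<and> gx (fst (zs n)) y = snd (zs n)" using R_E[OF zs(1)] by blast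
    then obtain ys where ys: "\<And>n. ys n \<in> closure Y" "\<And>n. gx (fst (zs n)) (ys n) = snd (zs n)"
      by metis
    then obtain y r where y: "y \<in> closure Y" and r: "strict_mono r" "(ys \<circ> r) \<longlonglongrightarrow> y"
      using compact_Y unfolding compact_def by meson
    have zr: "(zs \<circ> r) \<longlonglongrightarrow> z" by (rule LIMSEQ_subseq_LIMSEQ[OF zs(2) r(1)])
    have "(\<lambda>n. gx (fst ((zs \<circ> r) n)) ((ys \<circ> r) n)) \<longlonglongrightarrow> gx (fst z) y"
      by (rule tendsto_gx[OF tendsto_fst[OF zr] r(2)]) (use z zs R_X ys y in_closure in auto)
    moreover have "(\<lambda>n. gx (fst ((zs \<circ> r) n)) ((ys \<circ> r) n)) \<longlonglongrightarrow> snd z"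
      using tendsto_snd[OF zr] ys(2) by (simp add: o_def)
    ultimately have "gx (fst z) y = snd z" by (rule LIMSEQ_unique)
    then show "z \<in> R" using z y unfolding R_def by auto
  qed
  then have "R \<in> sets borel"
    using open_Times[OF open_X open_UNIV] by (metis borel_closed borel_open closed_closure sets.Int)
  have yb_R: "yb b X Y (fst z) (snd z) \<in> closure Y \<and> gx (fst z) (yb b X Y (fst z) (snd z)) = snd z"
    if "z \<in> R" for z
    using R_E[OF that] yb_gx[OF R_X[OF that]] by metis
  have cont: "continuous_on R (\<lambda>z. yb b X Y (fst z) (snd z))"
  proof (rule continuous_on_sequentiallyI)
    fix zs z assume zs: "\<forall>n. zs n \<in> R" "z \<in> R" "zs \<longlonglongrightarrow> z"
    show "(\<lambda>n. yb b X Y (fst (zs n)) (snd (zs n))) \<longlonglongrightarrow> yb b X Y (fst z) (snd z)"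
    proof (rule compact_tendsto_if_unique_limit[OF compact_Y])
      show "yb b X Y (fst (zs n)) (snd (zs n)) \<in> closure Y" for n using yb_R zs(1) by blast
      fix r l assume r: "strict_mono (r :: nat \<Rightarrow> nat)" and l: "l \<in> closure Y"
        "((\<lambda>n. yb b X Y (fst (zs n)) (snd (zs n))) \<circ> r) \<longlonglongrightarrow> l"
      have zr: "(zs \<circ> r) \<longlonglongrightarrow> z" by (rule LIMSEQ_subseq_LIMSEQ[OF zs(3) r(1)])
      have "(\<lambda>n. gx (fst ((zs \<circ> r) n)) (((\<lambda>n. yb b X Y (fst (zs n)) (snd (zs n))) \<circ> r) n)) \<longlonglongrightarrow> gx (fst z) l"
        by (rule tendsto_gx[OF tendsto_fst[OF zr] l(2)]) (use zs R_X l yb_R in auto)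
      moreover have "(\<lambda>n. gx (fst ((zs \<circ> r) n)) (((\<lambda>n. yb b X Y (fst (zs n)) (snd (zs n))) \<circ> r) n)) \<longlonglongrightarrow> snd z"
        using tendsto_snd[OF zr] yb_R zs(1) by (simp add: o_def)
      ultimately have "gx (fst z) l = snd z" by (rule LIMSEQ_unique)
      then show "l = yb b X Y (fst z) (snd z)" using yb_gx[OF R_X[OF zs(2)] l(1)] by simp
    qed
  qed
  define H where "H z = (if z \<in> R then yb b X Y (fst z) (snd z) else (THE y. False))" for z
  have "H \<in> borel_measurable borel"
    unfolding H_def by (rule borel_measurable_continuous_on_if[OF \<open>R \<in> sets borel\<close> cont continuous_on_const])
  moreover have "H (x, q) = yb b X Y x q" if "x \<in> X" for x q
  proof (cases "(x, q) \<in> R")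
    case True then show ?thesis by (simp add: H_def)
  next
    case False
    then have "(\<lambda>y. y \<in> closure Y \<and> gx x y = q) = (\<lambda>y. False)" using that unfolding R_def by blast
    then show ?thesis using False by (simp add: H_def yb_def the_inv_into_def)
  qed
  ultimately show ?thesis by (rule that)
qed

text \<open>Among products supporting \<open>u\<close> at \<open>x\<close>, and for the conjugate price \<open>v\<close>, the profit \<open>v y - c y\<close> is \<open>b x y - u x - c y\<close>, so maximal profit
is the same as minimal \<open>c y - b x y\<close>.\<close>

definition optimal_response :: "(real^'n \<Rightarrow> real) \<Rightarrow> (real^'n \<Rightarrow> real) \<Rightarrow> real^'n \<Rightarrow> real^'n \<Rightarrow> bool" where
  "optimal_response c u x y \<longleftrightarrow> y \<in> closure Y \<and> y \<in> supports b X u x \<and>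
     (\<forall>z\<in>closure Y. z \<in> supports b X u x \<longrightarrow> c y - b x y \<le> c z - b x z)"

context
  fixes \<mu> :: "(real^'n) measure"
  assumes prob: "prob_space \<mu>" and sets_mu: "sets \<mu> = sets (restrict_space borel X)"
begin

lemma space_mu: "space \<mu> = X"
  using sets_eq_imp_space_eq[OF sets_mu] by (simp add: space_restrict_space)

lemma sets_mu_iff: "A \<in> sets \<mu> \<longleftrightarrow> A \<subseteq> X \<and> A \<in> sets borel"
  using sets_restrict_space_iff[of X borel A] open_X by (simp add: sets_mu)

lemma borel_measurable_muI:
  assumes "g \<in> borel_measurable borel" shows "g \<in> borel_measurable (completion \<mu>)"
  using measurable_completion[of g \<mu> borel] measurable_restrict_space1[OF assms, of X]
    measurable_cong_sets[OF sets_mu refl, of borel] by blast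

lemma tie_breaking_response:
  assumes u: "b_convex b X Y u" and D: "tie_breaking_selection b c X Y \<mu> u D"
  shows "(\<lambda>x. yb b X Y x (D x)) \<in> borel_measurable (completion \<mu>)"
    and "AE x in completion \<mu>. optimal_response c u x (yb b X Y x (D x))"
proof -
  let ?v = "bstar_transform b X (\<lambda>x. ereal (u x))"
  have meas: "D \<in> borel_measurable (completion \<mu>)"
    and best: "\<And>x. x \<in> X \<Longrightarrow> yb b X Y x (D x) \<in> best_responses b Y ?v x"
    and tie: "\<And>x y. x \<in> X \<Longrightarrow> y \<in> best_responses b Y ?v x \<Longrightarrow>
      ?v y - ereal (c y) \<le> ?v (yb b X Y x (D x)) - ereal (c (yb b X Y x (D x)))"
    using D unfolding tie_breaking_selection_def Let_def by blast+
  obtain H where H: "H \<in> borel_measurable borel" "\<And>x q. x \<in> X \<Longrightarrow> H (x, q) = yb b X Y x q"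
    using yb_borel_measurable by blast
  have "(\<lambda>x. (x, D x)) \<in> borel_measurable (completion \<mu>)"
    by (intro borel_measurable_Pair meas borel_measurable_muI) simp
  then have "(\<lambda>x. H (x, D x)) \<in> borel_measurable (completion \<mu>)"
    by (rule measurable_compose[OF _ H(1)])
  then show "(\<lambda>x. yb b X Y x (D x)) \<in> borel_measurable (completion \<mu>)"
    by (rule measurable_cong[THEN iffD1, rotated]) (use H(2) space_mu in simp)
  have "optimal_response c u x (yb b X Y x (D x))" if x: "x \<in> X" for x
  proof -
    have cl: "x \<in> closure X" using in_closure x by blast
    obtain y0 where y0: "y0 \<in> closure Y" "y0 \<in> supports b X u x" using b_convex_has_support[OF u cl] by blast
    note eq = best_responses_eq_supports[OF cl y0]
    let ?y = "yb b X Y x (D x)"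
    have y: "?y \<in> closure Y" "?y \<in> supports b X u x" using best[OF x] unfolding eq by auto
    have "c ?y - b x ?y \<le> c z - b x z" if "z \<in> closure Y" "z \<in> supports b X u x" for z
      using tie[OF x, of z] that unfolding eq
      by (simp add: bstar_transform_at_support[OF cl y(2)] bstar_transform_at_support[OF cl that(2)])
    with y show ?thesis by (simp add: optimal_response_def)
  qed
  then show "AE x in completion \<mu>. optimal_response c u x (yb b X Y x (D x))"
    by (intro AE_I2) (simp add: space_mu)
qed

text \<open>Off the null set of types with several supports, the response is the unique support. It is
optimal for lack of competitors, and it is continuous there since supports are closed under limits.\<close>

lemma derivative_response:
  assumes u: "b_convex b X Y u" and D: "is_derivative_on X u D"
    and vanishes: "vanishes_on_lipschitz_hypersurfaces \<mu>"
  shows "(\<lambda>x. yb b X Y x (D x)) \<in> borel_measurable (completion \<mu>)"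
    and "AE x in completion \<mu>. optimal_response c u x (yb b X Y x (D x))"
proof -
  obtain \<S> where S: "countable \<S>" "\<And>S. S \<in> \<S> \<Longrightarrow> lipschitz_hypersurface S"
    and covered: "{x\<in>X. \<exists>y\<in>closure Y. \<exists>y'\<in>closure Y. y \<noteq> y' \<and> y \<in> supports b X u x \<and> y' \<in> supports b X u x} \<subseteq> \<Union>\<S>"
    using multiple_supports_covered[of u] by blast
  define Z where "Z = (\<Union>S\<in>\<S>. S \<inter> X)"
  have Z: "Z \<in> null_sets \<mu>"
    unfolding Z_def using S vanishes space_mu
    by (intro null_sets_UN') (auto simp: vanishes_on_lipschitz_hypersurfaces_def)
  have AE_Z: "AE x in completion \<mu>. x \<in> X - Z"
    using AE_not_in[OF null_sets_completionI[OF Z]] AE_space[of "completion \<mu>"]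
    by eventually_elim (simp add: space_mu)
  let ?g = "\<lambda>x. yb b X Y x (D x)"
  have unique: "y = y'" if "x \<in> X - Z" "y \<in> closure Y" "y' \<in> closure Y" "y \<in> supports b X u x" "y' \<in> supports b X u x"
    for x y y'
    using covered that unfolding Z_def by blast
  have g: "?g x \<in> closure Y \<and> ?g x \<in> supports b X u x" if x: "x \<in> X - Z" for x
  proof -
    have cl: "x \<in> closure X" and "x \<in> X" using in_closure x by auto
    obtain y where y: "y \<in> closure Y" "y \<in> supports b X u x" using b_convex_has_support[OF u cl] by blast
    have "u differentiable (at x)"
      using has_derivative_if_unique_support[OF u \<open>x \<in> X\<close>, of y] unique[OF x] y
      unfolding differentiable_def by metis
    then have "GDERIV u x :> D x" using D \<open>x \<in> X\<close> by (simp add: is_derivative_on_def)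
    then have "D x = gx x y" by (rule gradient_at_support[OF \<open>x \<in> X\<close> y])
    then show ?thesis using yb_gx[OF cl y(1)] y by simp
  qed
  show "AE x in completion \<mu>. optimal_response c u x (?g x)"
    using AE_Z
  proof eventually_elim
    fix x assume x: "x \<in> X - Z"
    have "z = ?g x" if "z \<in> closure Y" "z \<in> supports b X u x" for z
      using unique[OF x that(1) _ that(2)] g[OF x] by blast
    then show "optimal_response c u x (?g x)"
      unfolding optimal_response_def using g[OF x] by auto
  qed
  have cont: "continuous_on (X - Z) ?g"
  proof (rule continuous_on_sequentiallyI)
    fix xs x assume xs: "\<forall>n. xs n \<in> X - Z" "x \<in> X - Z" "xs \<longlonglongrightarrow> x"
    show "(\<lambda>n. ?g (xs n)) \<longlonglongrightarrow> ?g x"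
    proof (rule compact_tendsto_if_unique_limit[OF compact_Y])
      show "?g (xs n) \<in> closure Y" for n using g xs(1) by blast
      fix r l assume r: "strict_mono (r :: nat \<Rightarrow> nat)" and l: "l \<in> closure Y" "((\<lambda>n. ?g (xs n)) \<circ> r) \<longlonglongrightarrow> l"
      have "l \<in> supports b X u x"
        by (rule supports_limit[OF u LIMSEQ_subseq_LIMSEQ[OF xs(3) r] l(2)])
          (use xs l g in_closure in auto)
      then show "l = ?g x" using unique[OF xs(2)] l(1) g[OF xs(2)] by blast
    qed
  qed
  have "X - Z \<in> sets borel"
    using Z sets_mu_iff[of Z] open_X by (auto simp: null_sets_def)
  then have "(\<lambda>x. if x \<in> X - Z then ?g x else 0) \<in> borel_measurable borel"
    by (rule borel_measurable_continuous_on_if[OF _ cont continuous_on_const])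
  from borel_measurable_muI[OF this]
  show "?g \<in> borel_measurable (completion \<mu>)"
    by (rule completion.borel_measurable_AE_cong) (use AE_Z in eventually_elim, simp)
qed

text \<open>The cost and the utility are continuous on compact sets, so the density is bounded. The
functions are extended by zero off these sets in order to be Borel on the whole space.\<close>

lemma loss_density_integrable:
  assumes u: "b_convex b X Y u" and c: "bstar_convex b X Y c"
    and meas: "(\<lambda>x. yb b X Y x (D x)) \<in> borel_measurable (completion \<mu>)"
    and opt: "AE x in completion \<mu>. optimal_response c u x (yb b X Y x (D x))"
  shows "integrable (completion \<mu>) (loss_density b c X Y u D)"
proof -
  let ?g = "\<lambda>x. yb b X Y x (D x)"
  interpret swap: compact_kernel "\<lambda>y x. b x y" Y X by (rule swapped)
  have cont_u: "continuous_on (closure X) u" by (rule b_convex_continuous[OF u])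
  have cont_c: "continuous_on (closure Y) c"
    using swap.b_convex_continuous c unfolding bstar_convex_iff_b_convex by blast
  have bounded: "\<exists>B. \<forall>x\<in>K. \<bar>h x\<bar> \<le> B" if "compact K" "continuous_on K h" for K and h :: "'z::topological_space \<Rightarrow> real"
    using compact_imp_bounded[OF compact_continuous_image[OF that(2,1)]] unfolding bounded_iff by auto
  obtain Bu where Bu: "\<And>x. x \<in> closure X \<Longrightarrow> \<bar>u x\<bar> \<le> Bu" using bounded[OF compact_X cont_u] by blast
  obtain Bc where Bc: "\<And>y. y \<in> closure Y \<Longrightarrow> \<bar>c y\<bar> \<le> Bc" using bounded[OF compact_Y cont_c] by blast
  obtain Bb where Bb: "\<And>z. z \<in> closure X \<times> closure Y \<Longrightarrow> \<bar>f z\<bar> \<le> Bb"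
    using bounded[OF compact_Times[OF compact_X compact_Y] continuous_b] by blast
  define u' where "u' x = (if x \<in> closure X then u x else 0)" for x
  define c' where "c' y = (if y \<in> closure Y then c y else 0)" for y
  define b' where "b' z = (if z \<in> closure X \<times> closure Y then f z else 0)" for z
  have "u' \<in> borel_measurable borel" "c' \<in> borel_measurable borel" "b' \<in> borel_measurable borel"
    unfolding u'_def c'_def b'_def
    by (intro borel_measurable_continuous_on_if cont_u cont_c continuous_b continuous_on_const
        borel_closed closed_Times closed_closure)+
  note extensions = this
  have pair: "(\<lambda>x. (x, ?g x)) \<in> borel_measurable (completion \<mu>)"
    by (intro borel_measurable_Pair meas borel_measurable_muI) simp
  have "(\<lambda>x. u' x + c' (?g x) - b' (x, ?g x)) \<in> borel_measurable (completion \<mu>)"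
    using borel_measurable_muI[OF extensions(1)] measurable_compose[OF meas extensions(2)]
      measurable_compose[OF pair extensions(3)] by (intro borel_measurable_diff borel_measurable_add)
  moreover have inX: "AE x in completion \<mu>. x \<in> closure X \<and> ?g x \<in> closure Y"
    using opt AE_space[of "completion \<mu>"]
    by eventually_elim (use in_closure space_mu in \<open>auto simp: optimal_response_def\<close>)
  then have "AE x in completion \<mu>. u' x + c' (?g x) - b' (x, ?g x) = loss_density b c X Y u D x"
    by eventually_elim (simp add: u'_def c'_def b'_def loss_density_def)
  ultimately have "loss_density b c X Y u D \<in> borel_measurable (completion \<mu>)"
    by (rule completion.borel_measurable_AE_cong)
  moreover have "AE x in completion \<mu>. norm (loss_density b c X Y u D x) \<le> Bu + Bc + Bb"
    using inX
  proof eventually_elim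
    fix x assume "x \<in> closure X \<and> ?g x \<in> closure Y"
    then show "norm (loss_density b c X Y u D x) \<le> Bu + Bc + Bb"
      using Bu[of x] Bc[of "?g x"] Bb[of "(x, ?g x)"]
      unfolding loss_density_def real_norm_def by force
  qed
  ultimately show ?thesis
  proof -
    interpret completion_mu: prob_space "completion \<mu>" by (rule prob_space.prob_space_completion[OF prob])
    show ?thesis
      by (rule completion_mu.integrable_const_bound) fact+
  qed
qed

end

end

section \<open>Convexity of the minimization problem\<close>

theorem corollary4p4:
  fixes b :: "real^'n \<Rightarrow> real^'n \<Rightarrow> real"
    and c :: "real^'n \<Rightarrow> real"
    and X Y :: "(real^'n) set"
    and \<mu> :: "(real^'n) measure"
    and y_null :: "real^'n"
    and Du :: "(real^'n \<Rightarrow> real) \<Rightarrow> real^'n \<Rightarrow> real^'n"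
  assumes "prob_space \<mu>" and "sets \<mu> = sets (restrict_space borel X)"
    and "B0 b X Y" and "B1 b X Y" and "B2 b X Y" and "B3 b X Y"
    and "bstar_convex b X Y c"
    and "y_null \<in> closure Y"
    and "if vanishes_on_lipschitz_hypersurfaces \<mu>
         then \<forall>u\<in>U0 b c X Y y_null. is_derivative_on X u (Du u)
         else \<forall>u\<in>U0 b c X Y y_null. tie_breaking_selection b c X Y \<mu> u (Du u)"
  defines "L \<equiv> \<lambda>u. net_loss b c X Y \<mu> u (Du u)"
  shows "(\<forall>u0\<in>U0 b c X Y y_null. \<forall>u1\<in>U0 b c X Y y_null. \<forall>t\<in>{0..1}.
            (\<lambda>x. (1 - t) * u0 x + t * u1 x) \<in> U0 b c X Y y_null)
       \<and> (\<forall>u\<in>U0 b c X Y y_null. integrable (completion \<mu>) (loss_density b c X Y u (Du u)))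
       \<and> (\<forall>u0\<in>U0 b c X Y y_null. \<forall>u1\<in>U0 b c X Y y_null. \<forall>t\<in>{0..1}.
            L (\<lambda>x. (1 - t) * u0 x + t * u1 x) \<le> (1 - t) * L u0 + t * L u1)"
proof -
  have space: "space \<mu> = X"
    using sets_eq_imp_space_eq[OF assms(2)] by (simp add: space_restrict_space)
  interpret cross_curved_kernel b X Y
  proof
    show "X \<noteq> {}" using prob_space.not_empty[OF assms(1)] space by simp
    show "Y \<noteq> {}" using assms(8) by auto
  qed (rule assms)+
  let ?U = "U0 b c X Y y_null"
  have U_convex: "b_convex b X Y u" if "u \<in> ?U" for u using that by (simp add: U0_def)
  have response: "(\<lambda>x. yb b X Y x (Du u x)) \<in> borel_measurable (completion \<mu>)"
    "AE x in completion \<mu>. optimal_response c u x (yb b X Y x (Du u x))" if u: "u \<in> ?U" for u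
  proof (atomize (full), cases "vanishes_on_lipschitz_hypersurfaces \<mu>")
    case True
    then have "is_derivative_on X u (Du u)" using assms(9) u by simp
    from derivative_response[OF assms(1,2) U_convex[OF u] this True]
    show "(\<lambda>x. yb b X Y x (Du u x)) \<in> borel_measurable (completion \<mu>) \<and>
      (AE x in completion \<mu>. optimal_response c u x (yb b X Y x (Du u x)))" by blast
  next
    case False
    then have "tie_breaking_selection b c X Y \<mu> u (Du u)" using assms(9) u by simp
    from tie_breaking_response[OF assms(1,2) U_convex[OF u] this]
    show "(\<lambda>x. yb b X Y x (Du u x)) \<in> borel_measurable (completion \<mu>) \<and>
      (AE x in completion \<mu>. optimal_response c u x (yb b X Y x (Du u x)))" by blast
  qed
  have integrable: "integrable (completion \<mu>) (loss_density b c X Y u (Du u))" if u: "u \<in> ?U" for u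
    by (rule loss_density_integrable[OF assms(1,2) U_convex[OF u] assms(7) response[OF u]])
  have convex: "(\<lambda>x. (1 - t) * u0 x + t * u1 x) \<in> ?U"
    if u0: "u0 \<in> ?U" and u1: "u1 \<in> ?U" and t: "t \<in> {0..1}" for u0 u1 t
  proof -
    have "b x y_null - c y_null \<le> (1 - t) * u0 x + t * u1 x" if "x \<in> closure X" for x
    proof -
      have "(1 - t) * (b x y_null - c y_null) + t * (b x y_null - c y_null) \<le> (1 - t) * u0 x + t * u1 x"
        using u0 u1 t that by (intro add_mono mult_left_mono) (auto simp: U0_def)
      then show ?thesis by (simp add: algebra_simps)
    qed
    then show ?thesis
      using b_convex_combination[OF U_convex[OF u0] U_convex[OF u1] t] by (simp add: U0_def)
  qed
  have "L (\<lambda>x. (1 - t) * u0 x + t * u1 x) \<le> (1 - t) * L u0 + t * L u1"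
    if u0: "u0 \<in> ?U" and u1: "u1 \<in> ?U" and t: "t \<in> {0..1}" for u0 u1 t
  proof -
    define ut where "ut = (\<lambda>x. (1 - t) * u0 x + t * u1 x)"
    have ut: "ut \<in> ?U" unfolding ut_def by (rule convex[OF u0 u1 t])
    let ?l = "\<lambda>u. loss_density b c X Y u (Du u)"
    have "(LINT x|completion \<mu>. ?l ut x) \<le> (LINT x|completion \<mu>. (1 - t) * ?l u0 x + t * ?l u1 x)"
    proof (rule integral_mono_AE)
      show "integrable (completion \<mu>) (?l ut)" by (rule integrable[OF ut])
      show "integrable (completion \<mu>) (\<lambda>x. (1 - t) * ?l u0 x + t * ?l u1 x)"
        using integrable[OF u0] integrable[OF u1] by simp
      show "AE x in completion \<mu>. ?l ut x \<le> (1 - t) * ?l u0 x + t * ?l u1 x"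
        using response(2)[OF u0] response(2)[OF u1] response(2)[OF ut] AE_space[of "completion \<mu>"]
      proof eventually_elim
        fix x assume opt: "optimal_response c u0 x (yb b X Y x (Du u0 x))"
          "optimal_response c u1 x (yb b X Y x (Du u1 x))"
          "optimal_response c ut x (yb b X Y x (Du ut x))" and "x \<in> space (completion \<mu>)"
        then have x: "x \<in> closure X" using in_closure space by simp
        define y0 where "y0 = yb b X Y x (Du u0 x)"
        define y1 where "y1 = yb b X Y x (Du u1 x)"
        define yt where "yt = yb b X Y x (Du ut x)"
        obtain y where y: "y \<in> closure Y" "y \<in> supports b X ut x"
          and cost: "c y - b x y \<le> (1 - t) * (c y0 - b x y0) + t * (c y1 - b x y1)"
          using support_of_convex_combination[OF x _ _ _ _ t, of y0 u0 y1 u1] opt(1,2) assms(7)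
          unfolding optimal_response_def y0_def y1_def ut_def by blast
        have "c yt - b x yt \<le> c y - b x y"
          using opt(3) y unfolding optimal_response_def yt_def by blast
        with cost have "c yt - b x yt \<le> (1 - t) * (c y0 - b x y0) + t * (c y1 - b x y1)" by linarith
        then show "?l ut x \<le> (1 - t) * ?l u0 x + t * ?l u1 x"
          unfolding loss_density_def y0_def[symmetric] y1_def[symmetric] yt_def[symmetric]
          by (simp add: ut_def algebra_simps)
      qed
    qed
    also have "\<dots> = (1 - t) * (LINT x|completion \<mu>. ?l u0 x) + t * (LINT x|completion \<mu>. ?l u1 x)"
      using integrable[OF u0] integrable[OF u1] by simp
    finally show ?thesis unfolding L_def net_loss_def ut_def .
  qed
  with convex integrable show ?thesis by blast
qed

end
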